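(* Let $N\ge1$ be an integer, $\mathcal{H}_{1/2}\cong\mathbb{C}^2$ the spin $1/2$ representation space of $\mathrm{SU}(2)$, and $\mathrm{Inv}(\mathcal{H}_{1/2}^{\otimes N})$ the space of $\mathrm{SU}(2)$-invariant tensors in $\mathcal{H}_{1/2}^{\otimes N}$. For $N$ odd the space $\mathrm{Inv}(\mathcal{H}_{1/2}^{\otimes N})$ is trivial (zero), and for $N$ even it has the following decomposition into irreducible left $B$-modules: $$\mathrm{Inv}(\mathcal{H}_{1/2}^{\otimes N})=\bigoplus_{T_\lambda}\mathrm{Inv}_{T_\lambda}(\mathcal{H}_{1/2}^{\otimes N}),$$ where $\lambda=(N/2,N/2)$ and the direct sum is over all standard $\lambda$-tableaux $T_\lambda$. Each space $\mathrm{Inv}_{T_\lambda}(\mathcal{H}_{1/2}^{\otimes N})$ in this decomposition is 1-dimensional: $$\dim\mathrm{Inv}_{T_\lambda}(\mathcal{H}_{1/2}^{\otimes N})=1.$$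
   Context: $\mathrm{SU}(2)$ acts on $\mathcal{H}_{1/2}^{\otimes N}$ by $\rho_{1/2}(u)^{\otimes N}$, where $\rho_{1/2}$ is the fundamental representation. The permutation group $S_N$ acts from the right by $(v_1\otimes\cdots\otimes v_N)\cdot\sigma=v_{\sigma(1)}\otimes\cdots\otimes v_{\sigma(N)}$; this preserves $\mathrm{Inv}(\mathcal{H}_{1/2}^{\otimes N})$ and extends linearly to a right action of the group algebra $\mathbb{C}S_N$ (basis $e_g$, product $e_ge_h=e_{gh}$). $B$ is the algebra of linear endomorphisms of $\mathrm{Inv}(\mathcal{H}_{1/2}^{\otimes N})$ commuting with this right action of $S_N$. A Young diagram $\lambda$ with $N$ boxes corresponds to a partition $\lambda_1\ge\cdots\ge\lambda_k\ge1$ of $N$, with $\lambda_i$ boxes in row $i$. A $\lambda$-tableau is a bijective filling of the boxes with $1,\ldots,N$; it is standard if all rows and columns are increasing. For a $\lambda$-tableau $t$, let $P(t)$ (resp. $Q(t)$) be the subgroup of $S_N$ preserving each row (resp. each column) of $t$ as a set, $a(t)=\sum_{g\in P(t)}e_g$, $b(t)=\sum_{g\in Q(t)}\mathrm{sgn}(g)e_g$, and let the Young symmetrizer be $c_t=a(t)\,b(t)$. Put $e_{t}=\frac{\dim V_\lambda}{N!}c_{t}$, where $V_\lambda=\mathbb{C}S_N\,c_{t_{\rm can}}$ with $t_{\rm can}$ the canonical $\lambda$-tableau (boxes filled by consecutive numbers, row by row); $V_\lambda$ is the irreducible representation of $S_N$ labelled by $\lambda$. Finally $\mathrm{Inv}_{T_\lambda}(\mathcal{H}_{1/2}^{\otimes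 N})=\mathrm{Inv}(\mathcal{H}_{1/2}^{\otimes N})\,e_{T_\lambda}$. *)

theory Defs
  imports "HOL-Analysis.Analysis" "HOL-Library.Function_Algebras"
begin

section \<open>Complex vector spaces of functions\<close>

definition cscale :: "complex \<Rightarrow> ('a \<Rightarrow> complex) \<Rightarrow> 'a \<Rightarrow> complex" (infixr \<open>*\<^sub>c\<close> 75)
  where "c *\<^sub>c f = (\<lambda>x. c * f x)"

interpretation cfun: vector_space "cscale :: complex \<Rightarrow> ('a \<Rightarrow> complex) \<Rightarrow> 'a \<Rightarrow> complex"
  by standard (auto simp: cscale_def fun_eq_iff algebra_simps)

text \<open>Internal direct sum of a finite family of subspaces.\<close>

definition is_direct_sum ::
    "('a \<Rightarrow> complex) set \<Rightarrow> 'i set \<Rightarrow> ('i \<Rightarrow> ('a \<Rightarrow> complex) set) \<Rightarrow> bool"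
  where "is_direct_sum V I W \<longleftrightarrow>
    finite I \<and> (\<forall>i\<in>I. cfun.subspace (W i)) \<and>
    V = {\<Sum>i\<in>I. v i | v. v \<in> Pi I W} \<and>
    (\<forall>v\<in>Pi I W. (\<Sum>i\<in>I. v i) = 0 \<longrightarrow> (\<forall>i\<in>I. v i = 0))"


section \<open>The tensor power of the spin 1/2 representation\<close>

text \<open>
  An element of the \<open>N\<close>-th tensor power of \<open>complex ^ 2\<close> is given by its coordinates
  \<open>\<psi> w\<close> with respect to the tensors \<open>e (w 1) \<otimes> \<dots> \<otimes> e (w N)\<close> of standard basis vectors.
\<close>

definition words :: "nat \<Rightarrow> (nat \<Rightarrow> 2) set"
  where "words N = ({1..N} \<rightarrow>\<^sub>E UNIV)"

type_synonym tensor = "(nat \<Rightarrow> 2) \<Rightarrow> complex"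

definition tensors :: "nat \<Rightarrow> tensor set"
  where "tensors N = {\<psi>. \<forall>w. w \<notin> words N \<longrightarrow> \<psi> w = 0}"

definition pure :: "nat \<Rightarrow> (nat \<Rightarrow> complex ^ 2) \<Rightarrow> tensor"
  where "pure N v = (\<lambda>w. if w \<in> words N then (\<Prod>i\<in>{1..N}. v i $ w i) else 0)"

definition SU2 :: "(complex ^ 2 ^ 2) set"
  where "SU2 = {u. u ** (\<chi> i j. cnj (u $ j $ i)) = mat 1 \<and> det u = 1}"

text \<open>The \<open>N\<close>-th tensor power of the linear map \<open>u\<close>, in coordinates; see \<open>tensor_act_pure\<close>.\<close>

definition tensor_act :: "nat \<Rightarrow> complex ^ 2 ^ 2 \<Rightarrow> tensor \<Rightarrow> tensor"
  where "tensor_act N u \<psi> =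
    (\<lambda>w. if w \<in> words N then (\<Sum>w'\<in>words N. (\<Prod>i\<in>{1..N}. u $ w i $ w' i) * \<psi> w') else 0)"

definition Inv_space :: "nat \<Rightarrow> tensor set"
  where "Inv_space N = {\<psi> \<in> tensors N. \<forall>u\<in>SU2. tensor_act N u \<psi> = \<psi>}"

definition Sym :: "nat \<Rightarrow> (nat \<Rightarrow> nat) set"
  where "Sym N = {\<sigma>. \<sigma> permutes {1..N}}"

text \<open>The right action of permutations, in coordinates; see \<open>perm_act_pure\<close>.\<close>

definition perm_act :: "tensor \<Rightarrow> (nat \<Rightarrow> nat) \<Rightarrow> tensor"
  where "perm_act \<psi> \<sigma> = (\<lambda>w. \<psi> (w \<circ> inv \<sigma>))"

lemma finite_words [simp]: "finite (words N)"
  by (simp add: words_def finite_PiE)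

lemma comp_in_words_iff:
  assumes "\<sigma> \<in> Sym N"
  shows "w \<circ> \<sigma> \<in> words N \<longleftrightarrow> w \<in> words N"
proof -
  have p: "\<sigma> permutes {1..N}"
    using assms by (simp add: Sym_def)
  have "(\<forall>i. i \<notin> {1..N} \<longrightarrow> w (\<sigma> i) = undefined) \<longleftrightarrow> (\<forall>i. i \<notin> {1..N} \<longrightarrow> w i = undefined)"
    using permutes_not_in[OF p] by auto
  then show ?thesis
    by (simp add: words_def PiE_iff extensional_def)
qed

lemma pure_in_tensors: "pure N v \<in> tensors N"
  by (simp add: pure_def tensors_def)

lemma tensor_expansion:
  assumes "\<psi> \<in> tensors N"
  shows "\<psi> = (\<Sum>w\<in>words N. \<psi> w *\<^sub>c pure N (\<lambda>i. axis (w i) 1))"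
proof
  fix x
  have sum_app: "(\<Sum>w\<in>A. F w) x = (\<Sum>w\<in>A. F w x)" if "finite A"
    for A and F :: "(nat \<Rightarrow> 2) \<Rightarrow> tensor"
    using that by (induction A rule: finite_induct) simp_all
  have delta: "pure N (\<lambda>i. axis (w i) 1) x = (if w = x then 1 else 0)"
    if "w \<in> words N" for w
  proof (cases "w = x")
    case True
    then show ?thesis using that by (simp add: pure_def axis_def)
  next
    case False
    have "\<exists>i\<in>{1..N}. w i \<noteq> x i" if "x \<in> words N"
      using \<open>w \<in> words N\<close> that False unfolding words_def by (meson PiE_ext)
    then show ?thesis using False by (auto simp: pure_def axis_def)
  qed
  have "(\<Sum>w\<in>words N. \<psi> w *\<^sub>c pure N (\<lambda>i. axis (w i) 1)) x
      = (\<Sum>w\<in>words N. if w = x then \<psi> w else 0)"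
    by (simp add: sum_app cscale_def delta if_distrib cong: if_cong)
  also have "\<dots> = \<psi> x"
    using assms by (auto simp: tensors_def)
  finally show "\<psi> x = (\<Sum>w\<in>words N. \<psi> w *\<^sub>c pure N (\<lambda>i. axis (w i) 1)) x" ..
qed

lemma tensor_act_pure: "tensor_act N u (pure N v) = pure N (\<lambda>i. u *v v i)"
proof
  fix w
  have "(\<Sum>w'\<in>words N. (\<Prod>i\<in>{1..N}. u $ w i $ w' i) * pure N v w')
      = (\<Sum>w'\<in>words N. \<Prod>i\<in>{1..N}. u $ w i $ w' i * v i $ w' i)"
    by (simp add: pure_def prod.distrib)
  also have "\<dots> = (\<Prod>i\<in>{1..N}. \<Sum>k\<in>UNIV. u $ w i $ k * v i $ k)"
    unfolding words_def by (rule prod_sum_PiE [symmetric]) simp_all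
  finally show "tensor_act N u (pure N v) w = pure N (\<lambda>i. u *v v i) w"
    by (simp add: tensor_act_def pure_def matrix_vector_mult_def)
qed

lemma perm_act_pure:
  assumes "\<sigma> \<in> Sym N"
  shows "perm_act (pure N v) \<sigma> = pure N (v \<circ> \<sigma>)"
proof
  fix w
  have p: "\<sigma> permutes {1..N}"
    using assms by (simp add: Sym_def)
  then have "inv \<sigma> \<in> Sym N"
    by (simp add: Sym_def permutes_inv)
  then have words: "w \<circ> inv \<sigma> \<in> words N \<longleftrightarrow> w \<in> words N"
    by (rule comp_in_words_iff)
  have "(\<Prod>i\<in>{1..N}. v i $ w (inv \<sigma> i)) = (\<Prod>i\<in>{1..N}. v (\<sigma> i) $ w (inv \<sigma> (\<sigma> i)))"
    by (rule prod.permute [OF p, unfolded comp_def])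
  also have "\<dots> = (\<Prod>i\<in>{1..N}. v (\<sigma> i) $ w i)"
    using permutes_inverses(2)[OF p] by simp
  finally show "perm_act (pure N v) \<sigma> w = pure N (v \<circ> \<sigma>) w"
    using words by (simp add: perm_act_def pure_def)
qed


section \<open>The group algebra of the symmetric group\<close>

type_synonym galg = "(nat \<Rightarrow> nat) \<Rightarrow> complex"

definition group_algebra :: "nat \<Rightarrow> galg set"
  where "group_algebra N = {x. \<forall>g. g \<notin> Sym N \<longrightarrow> x g = 0}"

definition gbasis :: "(nat \<Rightarrow> nat) \<Rightarrow> galg"
  where "gbasis g = (\<lambda>h. if h = g then 1 else 0)"

definition gmult :: "nat \<Rightarrow> galg \<Rightarrow> galg \<Rightarrow> galg"
  where "gmult N x y = (\<Sum>g\<in>Sym N. \<Sum>h\<in>Sym N. (x g * y h) *\<^sub>c gbasis (g \<circ> h))"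

definition galg_act :: "nat \<Rightarrow> tensor \<Rightarrow> galg \<Rightarrow> tensor"
  where "galg_act N \<psi> x = (\<Sum>g\<in>Sym N. x g *\<^sub>c perm_act \<psi> g)"


section \<open>The commutant algebra and its modules\<close>

definition B_alg :: "nat \<Rightarrow> (tensor \<Rightarrow> tensor) set"
  where "B_alg N = {f \<in> Inv_space N \<rightarrow>\<^sub>E Inv_space N.
    (\<forall>\<psi>\<in>Inv_space N. \<forall>\<phi>\<in>Inv_space N. f (\<psi> + \<phi>) = f \<psi> + f \<phi>) \<and>
    (\<forall>c. \<forall>\<psi>\<in>Inv_space N. f (c *\<^sub>c \<psi>) = c *\<^sub>c f \<psi>) \<and>
    (\<forall>\<sigma>\<in>Sym N. \<forall>\<psi>\<in>Inv_space N. f (perm_act \<psi> \<sigma>) = perm_act (f \<psi>) \<sigma>)}"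

definition B_submodule :: "nat \<Rightarrow> tensor set \<Rightarrow> bool"
  where "B_submodule N W \<longleftrightarrow>
    W \<subseteq> Inv_space N \<and> cfun.subspace W \<and> (\<forall>f\<in>B_alg N. f ` W \<subseteq> W)"

definition B_irreducible :: "nat \<Rightarrow> tensor set \<Rightarrow> bool"
  where "B_irreducible N W \<longleftrightarrow>
    B_submodule N W \<and> W \<noteq> {0} \<and> (\<forall>U. B_submodule N U \<and> U \<subseteq> W \<longrightarrow> U = {0} \<or> U = W)"


section \<open>Tableaux and Young symmetrizers\<close>

text \<open>
  A partition is the list of its row lengths. Rows and columns are numbered from 0, while
  the entries of a tableau are \<open>1, \<dots>, N\<close>.
\<close>

definition boxes :: "nat list \<Rightarrow> (nat \<times> nat) set"
  where "boxes \<mu> = {(i, j). i < length \<mu> \<and> j < \<mu> ! i}"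

type_synonym tableau = "nat \<times> nat \<Rightarrow> nat"

definition tableaux :: "nat list \<Rightarrow> tableau set"
  where "tableaux \<mu> =
    {t \<in> extensional (boxes \<mu>). bij_betw t (boxes \<mu>) {1..sum_list \<mu>}}"

definition standard_tableaux :: "nat list \<Rightarrow> tableau set"
  where "standard_tableaux \<mu> = {t \<in> tableaux \<mu>.
    (\<forall>i j j'. (i, j) \<in> boxes \<mu> \<and> (i, j') \<in> boxes \<mu> \<and> j < j' \<longrightarrow> t (i, j) < t (i, j')) \<and>
    (\<forall>i i' j. (i, j) \<in> boxes \<mu> \<and> (i', j) \<in> boxes \<mu> \<and> i < i' \<longrightarrow> t (i, j) < t (i', j))}"

definition canonical_tableau :: "nat list \<Rightarrow> tableau"
  where "canonical_tableau \<mu> =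
    restrict (\<lambda>(i, j). sum_list (take i \<mu>) + j + 1) (boxes \<mu>)"

definition row_entries :: "nat list \<Rightarrow> tableau \<Rightarrow> nat \<Rightarrow> nat set"
  where "row_entries \<mu> t i = {t (i, j) | j. (i, j) \<in> boxes \<mu>}"

definition col_entries :: "nat list \<Rightarrow> tableau \<Rightarrow> nat \<Rightarrow> nat set"
  where "col_entries \<mu> t j = {t (i, j) | i. (i, j) \<in> boxes \<mu>}"

definition row_group :: "nat list \<Rightarrow> tableau \<Rightarrow> (nat \<Rightarrow> nat) set"
  where "row_group \<mu> t =
    {g \<in> Sym (sum_list \<mu>). \<forall>i. g ` row_entries \<mu> t i = row_entries \<mu> t i}"

definition col_group :: "nat list \<Rightarrow> tableau \<Rightarrow> (nat \<Rightarrow> nat) set"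
  where "col_group \<mu> t =
    {g \<in> Sym (sum_list \<mu>). \<forall>j. g ` col_entries \<mu> t j = col_entries \<mu> t j}"

definition row_symmetrizer :: "nat list \<Rightarrow> tableau \<Rightarrow> galg"
  where "row_symmetrizer \<mu> t = (\<Sum>g\<in>row_group \<mu> t. gbasis g)"

definition col_antisymmetrizer :: "nat list \<Rightarrow> tableau \<Rightarrow> galg"
  where "col_antisymmetrizer \<mu> t = (\<Sum>g\<in>col_group \<mu> t. of_int (sign g) *\<^sub>c gbasis g)"

definition young_symmetrizer :: "nat list \<Rightarrow> tableau \<Rightarrow> galg"
  where "young_symmetrizer \<mu> t =
    gmult (sum_list \<mu>) (row_symmetrizer \<mu> t) (col_antisymmetrizer \<mu> t)"

definition specht_module :: "nat list \<Rightarrow> galg set"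
  where "specht_module \<mu> =
    (\<lambda>x. gmult (sum_list \<mu>) x (young_symmetrizer \<mu> (canonical_tableau \<mu>)))
      ` group_algebra (sum_list \<mu>)"

definition young_idempotent :: "nat list \<Rightarrow> tableau \<Rightarrow> galg"
  where "young_idempotent \<mu> t =
    (of_nat (cfun.dim (specht_module \<mu>)) / fact (sum_list \<mu>)) *\<^sub>c young_symmetrizer \<mu> t"

definition Inv_tableau :: "nat list \<Rightarrow> tableau \<Rightarrow> tensor set"
  where "Inv_tableau \<mu> t =
    (\<lambda>\<psi>. galg_act (sum_list \<mu>) \<psi> (young_idempotent \<mu> t)) ` Inv_space (sum_list \<mu>)"

end

theory Submission
  imports Defs
begin

text \<open>
  Antisymmetrizing over the columns of a tableau \<open>t\<close> of shape \<open>(n, n)\<close> maps every tensor to a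
  multiple of \<open>singlets n t\<close>, the product of the singlets at the columns of \<open>t\<close>, and the Young
  symmetrizer does not kill \<open>singlets n t\<close>. So \<open>Inv_tableau [n, n] t\<close> is the line through
  \<open>singlets n t\<close>, and this line is characterized by its behaviour under the column
  transpositions, hence preserved by the commutant.

  Evaluate tensors at the words \<open>row_word n t\<close> which are 0 on the first and 1 on the
  second row of a standard tableau \<open>t\<close>. Ordered by the sum of the positions of the ones, the
  matrix of the values of the \<open>singlets n t\<close> at these words is unitriangular. An invariant tensor
  vanishing at all these words is zero by a Garnir-type straightening. Both facts together
  make the \<open>singlets n t\<close> with \<open>t\<close> standard a basis of the invariant tensors.
\<close>

lemma index_2_cases: "x = 0 \<or> x = 1" for x :: 2
  using exhaust_2[of x] by auto

lemma sum_fun_apply: "(\<Sum>i\<in>A. F i) x = (\<Sum>i\<in>A. F i x)"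
  for F :: "'i \<Rightarrow> 'a \<Rightarrow> 'b :: comm_monoid_add"
  by (induction A rule: infinite_finite_induct) auto

section \<open>The action of the group algebra\<close>

lemma finite_Sym [simp]: "finite (Sym N)"
  by (simp add: Sym_def finite_permutations)

lemma id_in_Sym [simp]: "id \<in> Sym N"
  by (simp add: Sym_def permutes_id)

lemma comp_in_Sym: "g \<in> Sym N \<Longrightarrow> h \<in> Sym N \<Longrightarrow> g \<circ> h \<in> Sym N"
  by (simp add: Sym_def permutes_compose)

lemma inv_in_Sym: "g \<in> Sym N \<Longrightarrow> inv g \<in> Sym N"
  by (simp add: Sym_def permutes_inv)

lemma bij_Sym: "g \<in> Sym N \<Longrightarrow> bij g"
  by (auto simp: Sym_def permutes_bij)

lemma inv_comp_Sym: "g \<in> Sym N \<Longrightarrow> h \<in> Sym N \<Longrightarrow> inv (g \<circ> h) = inv h \<circ> inv g"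
  by (simp add: bij_Sym o_inv_distrib)

lemma galg_act_apply: "galg_act N \<psi> x w = (\<Sum>g\<in>Sym N. x g * \<psi> (w \<circ> inv g))"
  by (simp add: galg_act_def sum_fun_apply cscale_def perm_act_def)

lemma gmult_apply:
  "gmult N x y k = (\<Sum>g\<in>Sym N. \<Sum>h\<in>Sym N. if k = g \<circ> h then x g * y h else 0)"
  by (simp add: gmult_def sum_fun_apply cscale_def gbasis_def if_distrib cong: if_cong)

text \<open>The inverse in \<open>perm_act\<close> reverses compositions, since
  \<open>inv (g \<circ> h) = inv h \<circ> inv g\<close>. Hence this is a right action: in a product
  the left factor acts first.\<close>

lemma galg_act_gmult: "galg_act N \<psi> (gmult N x y) = galg_act N (galg_act N \<psi> x) y"
proof
  fix w
  let ?S = "Sym N"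
  have "galg_act N \<psi> (gmult N x y) w
      = (\<Sum>k\<in>?S. \<Sum>g\<in>?S. \<Sum>h\<in>?S. if k = g \<circ> h then x g * y h * \<psi> (w \<circ> inv k) else 0)"
    by (simp add: galg_act_apply gmult_apply sum_distrib_right if_distrib[of "\<lambda>z. z * _"] cong: if_cong)
  also have "\<dots> = (\<Sum>g\<in>?S. \<Sum>h\<in>?S. \<Sum>k\<in>?S. if k = g \<circ> h then x g * y h * \<psi> (w \<circ> inv k) else 0)"
    by (subst sum.swap, rule sum.cong[OF refl], subst sum.swap, rule refl)
  also have "\<dots> = (\<Sum>g\<in>?S. \<Sum>h\<in>?S. x g * y h * \<psi> (w \<circ> inv h \<circ> inv g))"
    by (intro sum.cong refl) (simp add: comp_in_Sym inv_comp_Sym comp_assoc)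
  also have "\<dots> = (\<Sum>h\<in>?S. \<Sum>g\<in>?S. x g * y h * \<psi> (w \<circ> inv h \<circ> inv g))"
    by (rule sum.swap)
  also have "\<dots> = galg_act N (galg_act N \<psi> x) y w"
    by (simp add: galg_act_apply sum_distrib_left ac_simps)
  finally show "galg_act N \<psi> (gmult N x y) w = galg_act N (galg_act N \<psi> x) y w" .
qed

lemma galg_act_scale: "galg_act N \<psi> (c *\<^sub>c x) = c *\<^sub>c galg_act N \<psi> x"
  by (rule ext) (simp add: galg_act_apply cscale_def sum_distrib_left mult.assoc)

lemma galg_act_in_tensors:
  assumes "\<psi> \<in> tensors N"
  shows "galg_act N \<psi> x \<in> tensors N"
  using assms by (auto simp: tensors_def galg_act_apply comp_in_words_iff inv_in_Sym intro!: sum.neutral)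

lemma gmult_gbasis_id:
  assumes "x \<in> group_algebra N"
  shows "gmult N (gbasis id) x = x"
proof
  fix k
  have "gmult N (gbasis id) x k
      = (\<Sum>g\<in>Sym N. if g = id then \<Sum>h\<in>Sym N. if k = h then x h else 0 else 0)"
    unfolding gmult_apply by (intro sum.cong refl) (auto simp: gbasis_def intro!: sum.neutral)
  also have "\<dots> = x k"
    using assms by (auto simp: group_algebra_def)
  finally show "gmult N (gbasis id) x k = x k" .
qed

lemma gmult_in_group_algebra: "gmult N x y \<in> group_algebra N"
  by (auto simp: group_algebra_def gmult_apply intro!: sum.neutral dest: comp_in_Sym)

section \<open>Row symmetrizers and column antisymmetrizers\<close>

lemma row_group_subset: "row_group \<mu> t \<subseteq> Sym (sum_list \<mu>)"
  and col_group_subset: "col_group \<mu> t \<subseteq> Sym (sum_list \<mu>)"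
  by (auto simp: row_group_def col_group_def)

lemma finite_row_group [simp]: "finite (row_group \<mu> t)"
  and finite_col_group [simp]: "finite (col_group \<mu> t)"
  by (meson finite_Sym finite_subset row_group_subset col_group_subset)+

lemma galg_act_row_symmetrizer:
  "galg_act (sum_list \<mu>) \<psi> (row_symmetrizer \<mu> t) w = (\<Sum>g\<in>row_group \<mu> t. \<psi> (w \<circ> inv g))"
proof -
  have "row_symmetrizer \<mu> t g = (if g \<in> row_group \<mu> t then 1 else 0)" for g
    by (simp add: row_symmetrizer_def sum_fun_apply gbasis_def)
  then have "galg_act (sum_list \<mu>) \<psi> (row_symmetrizer \<mu> t) w
      = (\<Sum>g\<in>Sym (sum_list \<mu>). if g \<in> row_group \<mu> t then \<psi> (w \<circ> inv g) else 0)"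
    by (simp add: galg_act_apply if_distrib[of "\<lambda>z. z * _"] cong: if_cong)
  also have "\<dots> = (\<Sum>g\<in>row_group \<mu> t. \<psi> (w \<circ> inv g))"
    using row_group_subset by (simp add: sum.If_cases Int_absorb1)
  finally show ?thesis .
qed

lemma galg_act_col_antisymmetrizer:
  "galg_act (sum_list \<mu>) \<psi> (col_antisymmetrizer \<mu> t) w
    = (\<Sum>g\<in>col_group \<mu> t. of_int (sign g) * \<psi> (w \<circ> inv g))"
proof -
  have "col_antisymmetrizer \<mu> t g = (if g \<in> col_group \<mu> t then of_int (sign g) else 0)" for g
    by (simp add: col_antisymmetrizer_def sum_fun_apply gbasis_def cscale_def if_distrib cong: if_cong)
  then have "galg_act (sum_list \<mu>) \<psi> (col_antisymmetrizer \<mu> t) w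
      = (\<Sum>g\<in>Sym (sum_list \<mu>). if g \<in> col_group \<mu> t then of_int (sign g) * \<psi> (w \<circ> inv g) else 0)"
    by (simp add: galg_act_apply if_distrib[of "\<lambda>z. z * _"] cong: if_cong)
  also have "\<dots> = (\<Sum>g\<in>col_group \<mu> t. of_int (sign g) * \<psi> (w \<circ> inv g))"
    using col_group_subset by (simp add: sum.If_cases Int_absorb1)
  finally show ?thesis .
qed

text \<open>Stated for the stabilizer of an arbitrary family \<open>E\<close>, so that it serves
  \<open>row_group\<close> and \<open>col_group\<close> alike. The right translation reindexes the
  symmetrizing sums.\<close>

lemma perm_stabilizer_closed:
  assumes "G = {g \<in> Sym N. \<forall>i. g ` E i = E i}" "g \<in> G"
  shows "bij_betw (\<lambda>h. h \<circ> g) G G" "inv g \<in> G"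
proof -
  have comp: "h \<circ> k \<in> G" if "h \<in> G" "k \<in> G" for h k
  proof -
    have "(h \<circ> k) ` E i = E i" for i
      using that assms(1) by (simp only: image_comp[symmetric]) simp
    then show ?thesis
      using that assms(1) by (simp add: comp_in_Sym)
  qed
  have g: "bij g"
    using assms by (auto intro: bij_Sym)
  have "inv g ` E i = E i" for i
  proof -
    have "inv g ` g ` E i = E i"
      using g by (simp add: image_comp bij_is_inj)
    then show ?thesis
      using assms by simp
  qed
  then show i: "inv g \<in> G"
    using assms by (auto simp: inv_in_Sym)
  show "bij_betw (\<lambda>h. h \<circ> g) G G"
    by (rule bij_betwI[of _ _ _ "\<lambda>h. h \<circ> inv g"])
      (use i assms(2) comp g[THEN bij_is_inj, THEN inj_iff[THEN iffD1]]
        g[THEN bij_is_surj, THEN surj_iff[THEN iffD1]] in \<open>auto simp: comp_assoc\<close>)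
qed

text \<open>Acting by \<open>g\<close> only translates the summation index from \<open>h\<close> to
  \<open>h \<circ> g\<close>, which permutes the row group.\<close>

lemma perm_act_row_symmetrizer:
  assumes "g \<in> row_group \<mu> t"
  shows "perm_act (galg_act (sum_list \<mu>) \<psi> (row_symmetrizer \<mu> t)) g
    = galg_act (sum_list \<mu>) \<psi> (row_symmetrizer \<mu> t)"
proof
  fix w
  let ?G = "row_group \<mu> t"
  have g: "g \<in> Sym (sum_list \<mu>)"
    using assms row_group_subset by blast
  have "perm_act (galg_act (sum_list \<mu>) \<psi> (row_symmetrizer \<mu> t)) g w
      = (\<Sum>h\<in>?G. \<psi> (w \<circ> inv g \<circ> inv h))"
    by (simp add: perm_act_def galg_act_row_symmetrizer)
  also have "\<dots> = (\<Sum>h\<in>?G. \<psi> (w \<circ> inv (h \<circ> g)))"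
    using row_group_subset[of \<mu> t] g
    by (intro sum.cong refl) (auto simp: inv_comp_Sym comp_assoc subset_iff)
  also have "\<dots> = (\<Sum>h\<in>?G. \<psi> (w \<circ> inv h))"
    by (rule sum.reindex_bij_betw[OF perm_stabilizer_closed(1)[OF row_group_def assms]])
  finally show "perm_act (galg_act (sum_list \<mu>) \<psi> (row_symmetrizer \<mu> t)) g w
      = galg_act (sum_list \<mu>) \<psi> (row_symmetrizer \<mu> t) w"
    by (simp add: galg_act_row_symmetrizer)
qed

lemma sign_Sym_comp: "g \<in> Sym N \<Longrightarrow> h \<in> Sym N \<Longrightarrow> sign (g \<circ> h) = sign g * sign h"
  unfolding Sym_def by (intro sign_compose) (auto intro: permutation_permutes[THEN iffD2])

lemma perm_act_col_antisymmetrizer: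
  assumes "g \<in> col_group \<mu> t"
  shows "perm_act (galg_act (sum_list \<mu>) \<psi> (col_antisymmetrizer \<mu> t)) g
    = of_int (sign g) *\<^sub>c galg_act (sum_list \<mu>) \<psi> (col_antisymmetrizer \<mu> t)"
proof
  fix w
  let ?G = "col_group \<mu> t"
  have g: "g \<in> Sym (sum_list \<mu>)"
    using assms col_group_subset by blast
  have "perm_act (galg_act (sum_list \<mu>) \<psi> (col_antisymmetrizer \<mu> t)) g w
      = (\<Sum>h\<in>?G. of_int (sign h) * \<psi> (w \<circ> inv g \<circ> inv h))"
    by (simp add: perm_act_def galg_act_col_antisymmetrizer)
  also have "\<dots> = (\<Sum>h\<in>?G. of_int (sign g) * (of_int (sign (h \<circ> g)) * \<psi> (w \<circ> inv (h \<circ> g))))"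
  proof (intro sum.cong refl)
    fix h assume "h \<in> ?G"
    then have h: "h \<in> Sym (sum_list \<mu>)"
      using col_group_subset by blast
    have "(of_int (sign g) :: complex) * of_int (sign g) = 1"
      unfolding of_int_mult[symmetric] by (simp add: sign_idempotent)
    then show "of_int (sign h) * \<psi> (w \<circ> inv g \<circ> inv h)
        = of_int (sign g) * (of_int (sign (h \<circ> g)) * \<psi> (w \<circ> inv (h \<circ> g)))"
      using g h by (simp add: inv_comp_Sym comp_assoc sign_Sym_comp algebra_simps)
  qed
  also have "\<dots> = of_int (sign g) * (\<Sum>h\<in>?G. of_int (sign h) * \<psi> (w \<circ> inv h))"
    unfolding sum_distrib_left[symmetric]
    by (subst sum.reindex_bij_betw[OF perm_stabilizer_closed(1)[OF col_group_def assms],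
          of "\<lambda>h. of_int (sign h) * \<psi> (w \<circ> inv h)"]) (rule refl)
  finally show "perm_act (galg_act (sum_list \<mu>) \<psi> (col_antisymmetrizer \<mu> t)) g w
      = (of_int (sign g) *\<^sub>c galg_act (sum_list \<mu>) \<psi> (col_antisymmetrizer \<mu> t)) w"
    by (simp add: galg_act_col_antisymmetrizer cscale_def)
qed

section \<open>Tableaux with two rows of equal length\<close>

definition row_word :: "nat \<Rightarrow> tableau \<Rightarrow> nat \<Rightarrow> 2"
  where "row_word n t = (\<lambda>i\<in>{1..2 * n}. if \<exists>j<n. i = t (0, j) then 0 else 1)"

text \<open>The alternating form on the plane, that is, the coordinates of one singlet.\<close>

definition eps :: "2 \<Rightarrow> 2 \<Rightarrow> complex"
  where "eps a b = (if a = b then 0 else if a = 0 then 1 else - 1)"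

text \<open>The product over the columns of \<open>t\<close> of the singlet tensors
  \<open>e 0 \<otimes> e 1 - e 1 \<otimes> e 0\<close> at the two positions in the column.\<close>

definition singlets :: "nat \<Rightarrow> tableau \<Rightarrow> tensor"
  where "singlets n t =
    (\<lambda>w. if w \<in> words (2 * n) then \<Prod>j<n. eps (w (t (0, j))) (w (t (1, j))) else 0)"

lemma boxes_two_rows: "boxes [n, n] = {0, 1} \<times> {..<n}"
  by (auto simp: boxes_def less_Suc_eq nth_Cons split: nat.splits)

lemma sum_words_permute:
  assumes "g \<in> Sym N"
  shows "(\<Sum>w\<in>words N. F (w \<circ> g)) = (\<Sum>w\<in>words N. F w)"
proof (rule sum.reindex_bij_betw, rule bij_betwI[of _ _ _ "\<lambda>w. w \<circ> inv g"])
  have "inv g \<circ> g = id" "g \<circ> inv g = id"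
    using bij_Sym[OF assms] by (simp_all add: bij_is_inj bij_is_surj surj_iff[symmetric])
  then show "w \<circ> g \<circ> inv g = w" "w \<circ> inv g \<circ> g = w" for w :: "nat \<Rightarrow> 2"
    by (simp_all add: comp_assoc)
qed (use assms in \<open>auto simp: comp_in_words_iff inv_in_Sym simp del: comp_apply\<close>)

text \<open>Collects what holds for every tableau of this shape; it is instantiated at standard
  tableaux and, for the Specht module, at the canonical one.\<close>

locale two_row_tableau =
  fixes n :: nat and t :: tableau
  assumes tableau: "t \<in> tableaux [n, n]"
begin

lemma bij_boxes: "bij_betw t ({0, 1} \<times> {..<n}) {1..2 * n}"
  using tableau by (simp add: tableaux_def boxes_two_rows mult_2)

lemma entry_eq_iff:
  "i \<in> {0, 1} \<Longrightarrow> i' \<in> {0, 1} \<Longrightarrow> j < n \<Longrightarrow> j' < n \<Longrightarrow> t (i, j) = t (i', j') \<longleftrightarrow> i = i' \<and> j = j'"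
  using bij_betw_imp_inj_on[OF bij_boxes] by (auto dest!: inj_onD)

lemma entry_eq_iffs [simp]:
  assumes "j < n" "j' < n"
  shows "t (0, j) = t (0, j') \<longleftrightarrow> j = j'" "t (Suc 0, j) = t (Suc 0, j') \<longleftrightarrow> j = j'"
    "t (0, j) \<noteq> t (Suc 0, j')" "t (Suc 0, j) \<noteq> t (0, j')"
  using assms by (simp_all add: entry_eq_iff)

lemma entry_in: "j < n \<Longrightarrow> t (0, j) \<in> {1..2 * n}" "j < n \<Longrightarrow> t (1, j) \<in> {1..2 * n}"
  using bij_betwE[OF bij_boxes] by auto

lemma entry_cases:
  assumes "i \<in> {1..2 * n}"
  obtains j where "j < n" "i = t (0, j)" | j where "j < n" "i = t (1, j)"
proof -
  obtain x where x: "x \<in> {0, 1} \<times> {..<n}" "i = t x"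
    using assms bij_betw_imp_surj_on[OF bij_boxes] by (metis imageE)
  then obtain j where "j < n" "x = (0, j) \<or> x = (1, j)"
    by auto
  then show ?thesis
    using that x(2) by blast
qed

lemma sum_entries:
  "(\<Sum>i\<in>{1..2 * n}. h i) = (\<Sum>j<n. h (t (0, j)) + h (t (1, j)))"
  for h :: "nat \<Rightarrow> 'a :: comm_monoid_add"
proof -
  have "(\<Sum>i\<in>{1..2 * n}. h i) = (\<Sum>x\<in>{0, 1} \<times> {..<n}. h (t x))"
    by (rule sum.reindex_bij_betw[OF bij_boxes, symmetric])
  also have "\<dots> = (\<Sum>i\<in>{0, 1}. \<Sum>j<n. h (t (i, j)))"
    by (simp add: sum.cartesian_product)
  finally show ?thesis
    by (simp add: sum.distrib)
qed

lemma prod_entries: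
  "(\<Prod>i\<in>{1..2 * n}. h i) = (\<Prod>j<n. h (t (0, j)) * h (t (1, j)))"
  for h :: "nat \<Rightarrow> 'a :: comm_monoid_mult"
proof -
  have "(\<Prod>i\<in>{1..2 * n}. h i) = (\<Prod>x\<in>{0, 1} \<times> {..<n}. h (t x))"
    by (rule prod.reindex_bij_betw[OF bij_boxes, symmetric])
  also have "\<dots> = (\<Prod>i\<in>{0, 1}. \<Prod>j<n. h (t (i, j)))"
    by (simp add: prod.cartesian_product)
  finally show ?thesis
    by (simp add: prod.distrib)
qed

lemma words_eqI:
  assumes "w \<in> words (2 * n)" "w' \<in> words (2 * n)"
    and "\<And>j. j < n \<Longrightarrow> w (t (0, j)) = w' (t (0, j))"
    and "\<And>j. j < n \<Longrightarrow> w (t (1, j)) = w' (t (1, j))"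
  shows "w = w'"
proof (rule PiE_ext[of w "{1..2 * n}" "\<lambda>_. UNIV" w'])
  show "w i = w' i" if "i \<in> {1..2 * n}" for i
    using that by (rule entry_cases) (use assms(3,4) in simp_all)
qed (use assms in \<open>simp_all add: words_def\<close>)

lemma row_word_in_words: "row_word n t \<in> words (2 * n)"
  by (auto simp: row_word_def words_def)

lemma row_word_upper [simp]: "j < n \<Longrightarrow> row_word n t (t (0, j)) = 0"
  using entry_in(1) by (auto simp: row_word_def)

lemma row_word_lower [simp]: "j < n \<Longrightarrow> row_word n t (t (Suc 0, j)) = 1"
  using entry_in(2) by (auto simp: row_word_def)

lemma col_entries_eq: "col_entries [n, n] t j = (if j < n then {t (0, j), t (1, j)} else {})"
  by (auto simp: col_entries_def boxes_two_rows)

lemma row_entries_eq: "row_entries [n, n] t i = (if i < 2 then (\<lambda>j. t (i, j)) ` {..<n} else {})"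
  by (auto simp: row_entries_def boxes_two_rows less_2_cases_iff)

section \<open>Column transpositions and antisymmetric tensors\<close>

definition col_swap :: "nat \<Rightarrow> nat \<Rightarrow> nat"
  where "col_swap j = Transposition.transpose (t (0, j)) (t (1, j))"

lemma col_swap_in_Sym: "j < n \<Longrightarrow> col_swap j \<in> Sym (2 * n)"
  using entry_in by (auto simp: Sym_def col_swap_def intro!: permutes_swap_id)

lemma col_swap_in_col_group:
  assumes "j < n"
  shows "col_swap j \<in> col_group [n, n] t"
proof -
  have "col_swap j ` col_entries [n, n] t k = col_entries [n, n] t k" for k
    using assms by (cases "k = j") (auto simp: col_entries_eq col_swap_def Transposition.transpose_def)
  then show ?thesis
    using col_swap_in_Sym[OF assms] by (simp add: col_group_def mult_2)
qed

lemma sign_col_swap: "j < n \<Longrightarrow> sign (col_swap j) = - 1"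
  by (simp add: col_swap_def sign_swap_id)

lemma inv_col_swap: "inv (col_swap j) = col_swap j"
  by (simp add: col_swap_def)

lemma comp_col_swap_upper: "(w \<circ> col_swap j) (t (0, j)) = w (t (1, j))"
  and comp_col_swap_lower: "(w \<circ> col_swap j) (t (1, j)) = w (t (0, j))"
  by (simp_all add: col_swap_def)

lemma comp_col_swap_other:
  assumes "j < n" "k < n" "k \<noteq> j"
  shows "(w \<circ> col_swap j) (t (0, k)) = w (t (0, k))" "(w \<circ> col_swap j) (t (1, k)) = w (t (1, k))"
  using assms by (simp_all add: col_swap_def Transposition.transpose_def)

text \<open>Imposed on transpositions within columns, which already cut out a line. No inverse
  appears because \<open>col_swap j\<close> is an involution.\<close>

definition antisymmetric :: "tensor \<Rightarrow> bool"
  where "antisymmetric \<eta> \<longleftrightarrow>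
    \<eta> \<in> tensors (2 * n) \<and> (\<forall>j<n. \<forall>w. \<eta> (w \<circ> col_swap j) = - \<eta> w)"

text \<open>A word with equal letters in some column is fixed by that swap, so its value is its own
  negative. Otherwise swapping a column with 1 above 0 lowers the number of columns with 1 on top,
  until \<open>row_word n t\<close> is reached.\<close>

lemma antisymmetric_eq_0:
  assumes "antisymmetric \<eta>" "\<eta> (row_word n t) = 0"
  shows "\<eta> w = 0"
proof (induction "card {j. j < n \<and> w (t (0, j)) = 1}" arbitrary: w rule: less_induct)
  case less
  have anti: "\<eta> (v \<circ> col_swap j) = - \<eta> v" if "j < n" for v j
    using assms(1) that by (simp add: antisymmetric_def)
  show ?case
  proof (cases "w \<in> words (2 * n)")
    case False
    then show ?thesis
      using assms(1) by (simp add: antisymmetric_def tensors_def)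
  next
    case w: True
    have "w (t (0, j)) = w (t (1, j)) \<or> w (t (0, j)) = 1 \<and> w (t (1, j)) = 0
        \<or> w (t (0, j)) = 0 \<and> w (t (1, j)) = 1" for j
      using index_2_cases[of "w (t (0, j))"] index_2_cases[of "w (t (1, j))"] by auto
    then consider j where "j < n" "w (t (0, j)) = w (t (1, j))"
      | j where "j < n" "w (t (0, j)) = 1" "w (t (1, j)) = 0"
      | "\<forall>j<n. w (t (0, j)) = 0 \<and> w (t (1, j)) = 1"
      by blast
    then show ?thesis
    proof cases
      case (1 j)
      have "w \<circ> col_swap j = w"
        using 1 by (auto simp: fun_eq_iff col_swap_def Transposition.transpose_def)
      then show ?thesis
        using anti[OF 1(1), of w] by simp
    next
      case (2 j)
      let ?v = "w \<circ> col_swap j"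
      have "{k. k < n \<and> ?v (t (0, k)) = 1} = {k. k < n \<and> w (t (0, k)) = 1} - {j}"
      proof (intro set_eqI)
        fix k
        show "k \<in> {k. k < n \<and> ?v (t (0, k)) = 1} \<longleftrightarrow> k \<in> {k. k < n \<and> w (t (0, k)) = 1} - {j}"
          using 2 comp_col_swap_other(1)[OF 2(1), of k w] comp_col_swap_upper[of w j]
          by (cases "k = j") (auto simp del: comp_apply)
      qed
      then have "card {k. k < n \<and> ?v (t (0, k)) = 1} < card {k. k < n \<and> w (t (0, k)) = 1}"
        using 2 by (simp only:) (intro card_Diff1_less; simp)
      then have "\<eta> ?v = 0"
        by (rule less)
      then show ?thesis
        using anti[OF 2(1), of w] by simp
    next
      case 3
      then have "w = row_word n t"
        by (intro words_eqI w row_word_in_words) simp_all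
      then show ?thesis
        using assms(2) by simp
    qed
  qed
qed

lemma singlets_row_word: "singlets n t (row_word n t) = 1"
  by (simp add: singlets_def row_word_in_words eps_def)

lemma singlets_in_tensors: "singlets n t \<in> tensors (2 * n)"
  by (simp add: singlets_def tensors_def)

lemma antisymmetric_singlets: "antisymmetric (singlets n t)"
  unfolding antisymmetric_def
proof (intro conjI allI impI singlets_in_tensors)
  fix j and w :: "nat \<Rightarrow> 2" assume j: "j < n"
  let ?v = "w \<circ> col_swap j"
  let ?e = "\<lambda>w k. eps (w (t (0, k))) (w (t (1, k)))"
  have "(\<Prod>k<n. ?e ?v k) = ?e ?v j * (\<Prod>k\<in>{..<n} - {j}. ?e ?v k)"
    using j by (intro prod.remove) auto
  also have "\<dots> = - ?e w j * (\<Prod>k\<in>{..<n} - {j}. ?e w k)"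
  proof (intro arg_cong2[where f = "(*)"] prod.cong refl)
    show "?e ?v j = - ?e w j"
      unfolding comp_col_swap_upper comp_col_swap_lower
      using index_2_cases[of "w (t (0, j))"] index_2_cases[of "w (t (1, j))"]
      by (auto simp: eps_def)
  qed (use j comp_col_swap_other[OF j, of _ w] in simp)
  also have "\<dots> = - (\<Prod>k<n. ?e w k)"
    using j by (subst prod.remove[of "{..<n}" j]) auto
  finally show "singlets n t ?v = - singlets n t w"
    using comp_in_words_iff[OF col_swap_in_Sym[OF j], of w] by (simp add: singlets_def)
qed

text \<open>Both sides agree at \<open>row_word n t\<close>, where \<open>singlets n t\<close> is 1,
  so \<open>antisymmetric_eq_0\<close> applies to their difference.\<close>

lemma antisymmetric_eq_singlets:
  assumes "antisymmetric \<eta>"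
  shows "\<eta> = \<eta> (row_word n t) *\<^sub>c singlets n t"
proof
  fix w
  let ?d = "\<lambda>w. \<eta> w - \<eta> (row_word n t) * singlets n t w"
  have "antisymmetric ?d"
    using assms antisymmetric_singlets by (simp add: antisymmetric_def tensors_def)
  then have "?d w = 0"
    by (rule antisymmetric_eq_0) (simp add: singlets_row_word)
  then show "\<eta> w = (\<eta> (row_word n t) *\<^sub>c singlets n t) w"
    by (simp add: cscale_def)
qed

lemma antisymmetric_col_antisymmetrizer:
  assumes "\<psi> \<in> tensors (2 * n)"
  shows "antisymmetric (galg_act (2 * n) \<psi> (col_antisymmetrizer [n, n] t))"
  unfolding antisymmetric_def
proof (intro conjI allI impI galg_act_in_tensors assms)
  fix j w assume j: "j < n"
  let ?\<eta> = "galg_act (2 * n) \<psi> (col_antisymmetrizer [n, n] t)"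
  have "perm_act ?\<eta> (col_swap j) = of_int (sign (col_swap j)) *\<^sub>c ?\<eta>"
    using perm_act_col_antisymmetrizer[OF col_swap_in_col_group[OF j], of \<psi>] by (simp add: mult_2)
  then show "?\<eta> (w \<circ> col_swap j) = - ?\<eta> w"
    using j by (simp add: perm_act_def inv_col_swap sign_col_swap cscale_def fun_eq_iff)
qed

text \<open>The two entries of a column carry different letters, so a column permutation preserving
  the word cannot exchange them.\<close>

lemma col_group_fix_row_word:
  assumes "g \<in> col_group [n, n] t" "row_word n t \<circ> g = row_word n t"
  shows "g = id"
proof -
  have "g permutes {1..2 * n}"
    using assms(1) by (simp add: col_group_def Sym_def mult_2)
  moreover have "g i = i" if "i \<in> {1..2 * n}" for i
  proof -
    have col: "g ` {t (0, j), t (1, j)} = {t (0, j), t (1, j)}" if "j < n" for j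
      using assms(1) that by (auto simp: col_group_def col_entries_eq dest!: spec[of _ j])
    have w: "row_word n t (g i) = row_word n t i"
      using assms(2) by (metis comp_apply)
    show ?thesis
      using that
    proof (rule entry_cases)
      fix j assume "j < n" "i = t (0, j)"
      then show ?thesis
        using col[of j] w row_word_upper[of j] row_word_lower[of j] by force
    next
      fix j assume "j < n" "i = t (1, j)"
      then show ?thesis
        using col[of j] w row_word_upper[of j] row_word_lower[of j] by force
    qed
  qed
  ultimately have "g i = id i" for i
    by (cases "i \<in> {1..2 * n}") (auto dest: permutes_not_in simp del: atLeastAtMost_iff)
  then show ?thesis ..
qed

text \<open>Writing the singlet product as an antisymmetrized basis tensor gives its sign behaviour
  under the entire column group without factoring permutations into swaps. The normalization is 1
  because only the identity of the column group fixes \<open>row_word n t\<close>.\<close>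

lemma singlets_eq_col_antisymmetrizer:
  "singlets n t
    = galg_act (2 * n) (\<lambda>w. if w = row_word n t then 1 else 0) (col_antisymmetrizer [n, n] t)"
  (is "_ = galg_act _ ?\<delta> _")
proof -
  let ?\<eta> = "galg_act (2 * n) ?\<delta> (col_antisymmetrizer [n, n] t)"
  let ?Q = "col_group [n, n] t"
  have fix_iff: "row_word n t \<circ> inv g = row_word n t \<longleftrightarrow> g = id" if "g \<in> ?Q" for g
  proof
    assume "row_word n t \<circ> inv g = row_word n t"
    with perm_stabilizer_closed(2)[OF col_group_def that] have "inv g = id"
      by (rule col_group_fix_row_word)
    moreover have "bij g"
      using that col_group_subset bij_Sym by blast
    ultimately show "g = id"
      by (metis inv_id inv_inv_eq)
  qed simp
  have "?\<eta> (row_word n t) = (\<Sum>g\<in>?Q. of_int (sign g) * ?\<delta> (row_word n t \<circ> inv g))"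
    using galg_act_col_antisymmetrizer[of "[n, n]"] by (simp add: mult_2)
  also have "\<dots> = (\<Sum>g\<in>?Q. if g = id then 1 else 0)"
    by (intro sum.cong refl) (simp add: fix_iff sign_id)
  also have "\<dots> = 1"
    by (simp add: col_group_def)
  finally have "?\<eta> (row_word n t) = 1" .
  moreover have "antisymmetric ?\<eta>"
    by (rule antisymmetric_col_antisymmetrizer) (use row_word_in_words in \<open>auto simp: tensors_def\<close>)
  ultimately show ?thesis
    using antisymmetric_eq_singlets[of ?\<eta>] by (simp add: cscale_def)
qed

section \<open>Nonvanishing of the Young symmetrizer on singlets\<close>

lemma singlets_comp_col_group:
  assumes "g \<in> col_group [n, n] t"
  shows "singlets n t (w \<circ> g) = of_int (sign g) * singlets n t w"
proof -
  have g: "inv g \<in> col_group [n, n] t" "bij g" "permutation g"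
    using assms perm_stabilizer_closed(2)[OF col_group_def assms]
    by (auto simp: col_group_def Sym_def permutes_bij permutation_permutes)
  have "perm_act (singlets n t) (inv g) = of_int (sign (inv g)) *\<^sub>c singlets n t"
    using perm_act_col_antisymmetrizer[OF g(1)]
    by (simp add: singlets_eq_col_antisymmetrizer mult_2)
  then show ?thesis
    using g by (simp add: perm_act_def fun_eq_iff cscale_def inv_inv_eq sign_inverse)
qed

text \<open>Reality makes a vanishing sum of squares force each square to vanish.\<close>

lemma singlets_Reals: "singlets n t w \<in> \<real>"
proof -
  have "eps a b \<in> \<real>" for a b
    by (simp add: eps_def)
  then show ?thesis
    by (simp add: singlets_def prod_in_Reals)
qed

lemma row_word_comp_row_group:
  assumes "g \<in> row_group [n, n] t"
  shows "row_word n t \<circ> g = row_word n t"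
proof (rule words_eqI)
  have g: "g \<in> Sym (2 * n)"
    using assms by (simp add: row_group_def mult_2)
  show "row_word n t \<circ> g \<in> words (2 * n)"
    using g by (simp add: comp_in_words_iff row_word_in_words)
  have row: "g ` row_entries [n, n] t i = row_entries [n, n] t i" for i
    using assms by (simp add: row_group_def)
  have row0: "g ` (\<lambda>j. t (0, j)) ` {..<n} = (\<lambda>j. t (0, j)) ` {..<n}"
    and row1: "g ` (\<lambda>j. t (1, j)) ` {..<n} = (\<lambda>j. t (1, j)) ` {..<n}"
    using row[of 0] row[of 1] by (simp_all add: row_entries_eq)
  show "(row_word n t \<circ> g) (t (0, j)) = row_word n t (t (0, j))" if "j < n" for j
  proof -
    have "g (t (0, j)) \<in> (\<lambda>j. t (0, j)) ` {..<n}"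
      using that row0 by blast
    then obtain k where "k < n" "g (t (0, j)) = t (0, k)"
      by blast
    then show ?thesis
      using that by simp
  qed
  show "(row_word n t \<circ> g) (t (1, j)) = row_word n t (t (1, j))" if "j < n" for j
  proof -
    have "g (t (1, j)) \<in> (\<lambda>j. t (1, j)) ` {..<n}"
      using that row1 by blast
    then obtain k where "k < n" "g (t (1, j)) = t (1, k)"
      by blast
    then show ?thesis
      using that by simp
  qed
qed (rule row_word_in_words)

text \<open>With \<open>s = singlets n t\<close>, the pairing of \<open>s\<close> with \<open>s a b\<close> is a positive multiple of that
  of \<open>s\<close> with \<open>s a\<close>, which in turn is a positive multiple of the squared norm of the real,
  nonzero tensor \<open>s a\<close>.\<close>

lemma singlets_young_symmetrizer_neq_0:
  "galg_act (2 * n) (singlets n t) (young_symmetrizer [n, n] t) \<noteq> 0"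
proof
  let ?s = "singlets n t"
  let ?W = "words (2 * n)"
  let ?P = "row_group [n, n] t"
  let ?Q = "col_group [n, n] t"
  define \<phi> where "\<phi> = galg_act (2 * n) ?s (row_symmetrizer [n, n] t)"
  define \<eta> where "\<eta> = galg_act (2 * n) \<phi> (col_antisymmetrizer [n, n] t)"
  assume "galg_act (2 * n) ?s (young_symmetrizer [n, n] t) = 0"
  then have "\<eta> = 0"
    by (simp add: \<eta>_def \<phi>_def young_symmetrizer_def galg_act_gmult mult_2)
  have id: "id \<in> ?P" "id \<in> ?Q"
    using id_in_Sym[of "n + n"] by (simp_all add: row_group_def col_group_def)
  have \<phi>: "\<phi> w = (\<Sum>g\<in>?P. ?s (w \<circ> inv g))" for w
    using galg_act_row_symmetrizer[of "[n, n]"] by (simp add: \<phi>_def mult_2)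
  have \<eta>: "\<eta> w = (\<Sum>g\<in>?Q. of_int (sign g) * \<phi> (w \<circ> inv g))" for w
    using galg_act_col_antisymmetrizer[of "[n, n]"] by (simp add: \<eta>_def mult_2)
  have Sym: "g \<in> Sym (2 * n)" if "g \<in> ?P \<or> g \<in> ?Q" for g
    using that by (auto simp: row_group_def col_group_def mult_2)
  have cancel: "w \<circ> g \<circ> inv g = w" if "g \<in> ?P \<or> g \<in> ?Q" for g and w :: "nat \<Rightarrow> 2"
    using bij_Sym[OF Sym[OF that]] by (metis bij_is_surj comp_assoc comp_id surj_iff)
  have \<phi>_comp: "\<phi> (w \<circ> g) = \<phi> w" if "g \<in> ?P" for g w
  proof -
    have "perm_act \<phi> (inv g) = \<phi>"
      using perm_act_row_symmetrizer[OF perm_stabilizer_closed(2)[OF row_group_def that], of ?s]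
      by (simp add: \<phi>_def mult_2)
    then show ?thesis
      using bij_Sym[OF Sym, of g] that by (simp add: perm_act_def fun_eq_iff inv_inv_eq)
  qed
  have "0 = (\<Sum>w\<in>?W. ?s w * \<eta> w)"
    using \<open>\<eta> = 0\<close> by simp
  also have "\<dots> = (\<Sum>g\<in>?Q. \<Sum>w\<in>?W. of_int (sign g) * (?s w * \<phi> (w \<circ> inv g)))"
    unfolding \<eta> sum_distrib_left by (subst sum.swap) (simp add: ac_simps)
  \<comment> \<open>Replacing \<open>w\<close> by \<open>w \<circ> g\<close> moves \<open>g\<close>
    onto the singlets, where it contributes a second \<open>sign g\<close>; all terms of the outer
    sum become the same pairing.\<close>
  also have "\<dots> = (\<Sum>g\<in>?Q. \<Sum>w\<in>?W. ?s w * \<phi> w)"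
  proof (rule sum.cong[OF refl])
    fix g assume g: "g \<in> ?Q"
    have "(of_int (sign g) :: complex) * of_int (sign g) = 1"
      unfolding of_int_mult[symmetric] by (simp add: sign_idempotent)
    then have "of_int (sign g) * (?s (w \<circ> g) * \<phi> (w \<circ> g \<circ> inv g)) = ?s w * \<phi> w" for w
      using g cancel[of g w] singlets_comp_col_group[OF g, of w] by (simp add: mult.assoc[symmetric])
    then show "(\<Sum>w\<in>?W. of_int (sign g) * (?s w * \<phi> (w \<circ> inv g))) = (\<Sum>w\<in>?W. ?s w * \<phi> w)"
      using sum_words_permute[OF Sym, of g "\<lambda>w. of_int (sign g) * (?s w * \<phi> (w \<circ> inv g))"] g
      by simp
  qed
  also have "\<dots> = of_nat (card ?Q) * (\<Sum>w\<in>?W. ?s w * \<phi> w)"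
    by simp
  finally have "(\<Sum>w\<in>?W. ?s w * \<phi> w) = 0"
    using id by auto
  \<comment> \<open>Unfolding only the first factor and using that \<open>\<phi>\<close> is
    invariant under row permutations makes this a multiple of the pairing just shown to
    vanish.\<close>
  have "(\<Sum>w\<in>?W. \<phi> w * \<phi> w) = (\<Sum>w\<in>?W. \<Sum>g\<in>?P. ?s (w \<circ> inv g) * \<phi> w)"
    unfolding sum_distrib_right[symmetric] by (subst (1) \<phi>) (rule refl)
  also have "\<dots> = (\<Sum>g\<in>?P. \<Sum>w\<in>?W. ?s (w \<circ> inv g) * \<phi> w)"
    by (rule sum.swap)
  also have "\<dots> = (\<Sum>g\<in>?P. \<Sum>w\<in>?W. ?s w * \<phi> w)"
  proof (rule sum.cong[OF refl])
    fix g assume g: "g \<in> ?P"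
    then have "?s (w \<circ> g \<circ> inv g) * \<phi> (w \<circ> g) = ?s w * \<phi> w" for w
      using cancel[of g w] \<phi>_comp[OF g, of w] by simp
    then show "(\<Sum>w\<in>?W. ?s (w \<circ> inv g) * \<phi> w) = (\<Sum>w\<in>?W. ?s w * \<phi> w)"
      using sum_words_permute[OF Sym, of g "\<lambda>w. ?s (w \<circ> inv g) * \<phi> w"] g by simp
  qed
  finally have sq: "(\<Sum>w\<in>?W. \<phi> w * \<phi> w) = 0"
    using \<open>(\<Sum>w\<in>?W. ?s w * \<phi> w) = 0\<close> by simp
  have "\<phi> w \<in> \<real>" for w
    unfolding \<phi> by (intro sum_in_Reals singlets_Reals)
  then have Im: "Im (\<phi> w) = 0" for w
    by (simp add: complex_is_Real_iff)
  have "Re (\<phi> w * \<phi> w) = (Re (\<phi> w))\<^sup>2" for w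
    by (simp add: power2_eq_square Im)
  then have "(\<Sum>w\<in>?W. (Re (\<phi> w))\<^sup>2) = 0"
    using arg_cong[OF sq, of Re] by simp
  then have "Re (\<phi> (row_word n t)) = 0"
    using row_word_in_words by (simp add: sum_nonneg_eq_0_iff)
  \<comment> \<open>Row permutations fix \<open>row_word n t\<close>, so each summand is the value 1
    of the singlets there.\<close>
  moreover have "\<phi> (row_word n t) = of_nat (card ?P)"
    unfolding \<phi>
    using row_word_comp_row_group[OF perm_stabilizer_closed(2)[OF row_group_def]] singlets_row_word
    by simp
  ultimately show False
    using id by auto
qed

text \<open>The row symmetrizer acts first; whatever it yields, the column antisymmetrizer then
  lands in the line of antisymmetric tensors.\<close>

lemma galg_act_young_symmetrizer:
  assumes "\<psi> \<in> tensors (2 * n)"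
  shows "\<exists>c. galg_act (2 * n) \<psi> (young_symmetrizer [n, n] t) = c *\<^sub>c singlets n t"
  using antisymmetric_eq_singlets[OF antisymmetric_col_antisymmetrizer[OF galg_act_in_tensors[OF assms]]]
  by (auto simp: young_symmetrizer_def galg_act_gmult mult_2)

end

section \<open>Invariant tensors\<close>

lemma subspace_Inv_space: "cfun.subspace (Inv_space N)"
proof -
  have "tensor_act N u (\<psi> + \<phi>) = tensor_act N u \<psi> + tensor_act N u \<phi>" for u \<psi> \<phi>
    by (simp add: tensor_act_def fun_eq_iff distrib_left sum.distrib)
  moreover have "tensor_act N u (c *\<^sub>c \<psi>) = c *\<^sub>c tensor_act N u \<psi>" for u c \<psi>
    by (simp add: tensor_act_def fun_eq_iff cscale_def sum_distrib_left ac_simps)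
  moreover have "tensor_act N u 0 = 0" for u
    by (simp add: tensor_act_def fun_eq_iff)
  ultimately show ?thesis
    unfolding cfun.subspace_def by (simp add: Inv_space_def tensors_def cscale_def)
qed

text \<open>Sums and determinants over the index type expand at the indices 1 and 2, while words use
  the letters 0 and 1; this equation reconciles the two.\<close>

lemma two_eq_zero_2: "(2 :: 2) = 0"
  by simp

text \<open>Entrywise form of u E u^T = (det u) E, with E the matrix of the alternating
  form.\<close>

lemma eps_invariant:
  "(\<Sum>a\<in>UNIV. \<Sum>b\<in>UNIV. u $ x $ a * u $ y $ b * eps a b) = det u * eps x y"
  using index_2_cases[of x] index_2_cases[of y]
  by (auto simp: eps_def sum_2 det_2 two_eq_zero_2)

section \<open>Invariance of products of singlets\<close>

context two_row_tableau
begin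

text \<open>A word is an independent choice of a pair of letters for each column, so the sum
  factorizes by distributivity.\<close>

lemma sum_words_prod_columns:
  "(\<Sum>w\<in>words (2 * n). \<Prod>j<n. G j (w (t (0, j))) (w (t (1, j))))
    = (\<Prod>j<n. \<Sum>a\<in>UNIV. \<Sum>b\<in>UNIV. G j a b :: complex)"
proof -
  let ?C = "{..<n} \<rightarrow>\<^sub>E (UNIV :: (2 \<times> 2) set)"
  define pairs where "pairs w = (\<lambda>j\<in>{..<n}. (w (t (0, j)), w (t (1, j))))" for w :: "nat \<Rightarrow> 2"
  \<comment> \<open>The inverse of \<open>pairs\<close>: inverting \<open>t\<close> finds the box
    holding position \<open>i\<close>, and its row selects the component.\<close>
  define word where "word p = (\<lambda>i\<in>{1..2 * n}. case the_inv_into ({0, 1} \<times> {..<n}) t i of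
    (r, j) \<Rightarrow> if r = 0 then fst (p j) else snd (p j))" for p :: "nat \<Rightarrow> 2 \<times> 2"
  have inv: "the_inv_into ({0, 1} \<times> {..<n}) t (t x) = x" if "x \<in> {0, 1} \<times> {..<n}" for x
    using that bij_boxes by (intro the_inv_into_f_f) (auto simp: bij_betw_def)
  have word: "word p (t (0, j)) = fst (p j)" "word p (t (1, j)) = snd (p j)" if "j < n" for p j
    using that entry_in[OF that] inv[of "(0, j)"] inv[of "(1, j)"] by (simp_all add: word_def)
  have "(\<Sum>w\<in>words (2 * n). \<Prod>j<n. G j (w (t (0, j))) (w (t (1, j))))
      = (\<Sum>p\<in>?C. \<Prod>j<n. G j (fst (p j)) (snd (p j)))"
  proof (rule sum.reindex_bij_witness[of _ word pairs])
    fix w assume w: "w \<in> words (2 * n)"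
    show "word (pairs w) = w"
      by (rule words_eqI) (use word w in \<open>auto simp: pairs_def word_def words_def\<close>)
  next
    fix p assume p: "p \<in> ?C"
    show "pairs (word p) = p"
      using p word by (auto simp: pairs_def fun_eq_iff PiE_def extensional_def)
  qed (auto simp: pairs_def word_def words_def)
  also have "\<dots> = (\<Prod>j<n. \<Sum>p\<in>UNIV. G j (fst p) (snd p))"
    by (rule prod_sum_PiE[symmetric]) simp_all
  also have "\<dots> = (\<Prod>j<n. \<Sum>a\<in>UNIV. \<Sum>b\<in>UNIV. G j a b)"
    by (simp add: sum.cartesian_product UNIV_Times_UNIV[symmetric] case_prod_unfold del: UNIV_Times_UNIV)
  finally show ?thesis .
qed

text \<open>The tensor power of \<open>u\<close> acts on each column separately, where it multiplies
  the singlet by \<open>det u = 1\<close>.\<close>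

lemma singlets_in_Inv_space: "singlets n t \<in> Inv_space (2 * n)"
  unfolding Inv_space_def
proof (intro CollectI conjI ballI singlets_in_tensors)
  fix u assume u: "u \<in> SU2"
  show "tensor_act (2 * n) u (singlets n t) = singlets n t"
  proof
    fix w
    show "tensor_act (2 * n) u (singlets n t) w = singlets n t w"
    proof (cases "w \<in> words (2 * n)")
      case True
      let ?x = "\<lambda>j. w (t (0, j))" and ?y = "\<lambda>j. w (t (1, j))"
      have "tensor_act (2 * n) u (singlets n t) w
          = (\<Sum>w'\<in>words (2 * n). \<Prod>j<n. u $ ?x j $ w' (t (0, j)) * u $ ?y j $ w' (t (1, j))
              * eps (w' (t (0, j))) (w' (t (1, j))))"
        using True unfolding tensor_act_def prod_entries by (simp add: singlets_def prod.distrib)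
      also have "\<dots> = (\<Prod>j<n. eps (?x j) (?y j))"
        using u sum_words_prod_columns[where G = "\<lambda>j a b. u $ ?x j $ a * u $ ?y j $ b * eps a b"]
        by (simp only: eps_invariant) (simp add: SU2_def)
      finally show ?thesis
        using True by (simp add: singlets_def)
    qed (simp add: tensor_act_def singlets_def)
  qed
qed

end

section \<open>Weights of invariant tensors\<close>

lemma words_eq_iff:
  assumes "w \<in> words N" "w' \<in> words N"
  shows "w = w' \<longleftrightarrow> (\<forall>i\<in>{1..N}. w i = w' i)"
  using assms PiE_ext[of w "{1..N}" "\<lambda>_. UNIV" w'] by (auto simp: words_def)

lemma card_zeros_ones:
  "card {i \<in> {1..N}. w i = 0} + card {i \<in> {1..N}. w i = 1} = N" for w :: "nat \<Rightarrow> 2"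
proof -
  have "{i \<in> {1..N}. w i = 0} \<union> {i \<in> {1..N}. w i = 1} = {1..N}"
    using index_2_cases by auto
  moreover have "{i \<in> {1..N}. w i = 0} \<inter> {i \<in> {1..N}. w i = 1} = {}"
    by auto
  ultimately show ?thesis
    using card_Un_disjoint[of "{i \<in> {1..N}. w i = 0}" "{i \<in> {1..N}. w i = 1}"] by simp
qed

text \<open>The diagonal matrix with entries z and cnj z, for z on the unit circle, multiplies the
  value at \<open>w\<close> by a power of z whose exponent is the number of zeros minus the number
  of ones.\<close>

lemma Inv_space_weight_zero:
  assumes "\<psi> \<in> Inv_space N" "w \<in> words N" "\<psi> w \<noteq> 0"
  shows "card {i \<in> {1..N}. w i = 0} = card {i \<in> {1..N}. w i = 1}" (is "?a = ?b")
proof (cases "N = 0")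
  case False
  \<comment> \<open>With this angle the powers of \<open>z\<close> with exponents up to
    \<open>N\<close> have arguments in [0, pi], where the cosine is injective; so this one group
    element tells all letter counts apart.\<close>
  define z where "z = cis (pi / N)"
  define d :: "2 \<Rightarrow> complex" where "d x = (if x = 0 then z else cnj z)" for x
  define u :: "complex ^ 2 ^ 2" where "u = (\<chi> i j. if i = j then d i else 0)"
  have z: "z * cnj z = 1" "cnj z * z = 1"
    by (simp_all add: z_def cis_cnj cis_mult)
  then have "u \<in> SU2"
    by (simp add: SU2_def vec_eq_iff forall_2 matrix_matrix_mult_def sum_2 mat_def det_2 two_eq_zero_2 u_def d_def)
  then have "\<psi> w = tensor_act N u \<psi> w"
    using assms(1) by (simp add: Inv_space_def)
  also have "\<dots> = (\<Sum>w'\<in>words N. (\<Prod>i\<in>{1..N}. u $ w i $ w' i) * \<psi> w')"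
    using assms(2) by (simp add: tensor_act_def)
  also have "\<dots> = (\<Sum>w'\<in>words N. if w' = w then (\<Prod>i\<in>{1..N}. d (w i)) * \<psi> w else 0)"
  proof (intro sum.cong refl)
    fix w' assume "w' \<in> words N"
    then have "(\<Prod>i\<in>{1..N}. u $ w i $ w' i) = 0" if "w' \<noteq> w"
      using that words_eq_iff[of w' N w] assms(2) by (force simp: u_def)
    then show "(\<Prod>i\<in>{1..N}. u $ w i $ w' i) * \<psi> w'
        = (if w' = w then (\<Prod>i\<in>{1..N}. d (w i)) * \<psi> w else 0)"
      by (simp add: u_def)
  qed
  also have "\<dots> = (\<Prod>i\<in>{1..N}. d (w i)) * \<psi> w"
    using assms(2) by simp
  finally have 1: "(\<Prod>i\<in>{1..N}. d (w i)) = 1"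
    using assms(3) by simp
  have "{1..N} \<inter> - {i. w i = 0} = {i \<in> {1..N}. w i = 1}" "{1..N} \<inter> {i. w i = 0} = {i \<in> {1..N}. w i = 0}"
    using index_2_cases by auto
  then have "(\<Prod>i\<in>{1..N}. d (w i)) = z ^ ?a * cnj z ^ ?b"
    unfolding d_def by (subst prod.If_cases) simp_all
  with 1 have "z ^ ?b = z ^ ?a * (cnj z * z) ^ ?b"
    by (simp add: power_mult_distrib)
  then have "z ^ ?b = z ^ ?a"
    by (simp only: z power_one mult_1_right)
  then have "cis (?b * (pi / N)) = cis (?a * (pi / N))"
    unfolding z_def Complex.DeMoivre .
  from arg_cong[OF this, of Re] have cos: "cos (?b * (pi / N)) = cos (?a * (pi / N))"
    by (simp only: cis.sel)
  have bounds: "0 \<le> c * (pi / N)" "c * (pi / N) \<le> pi" if "c \<le> N" for c :: nat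
    using that False by (simp_all add: field_simps)
  have "?a \<le> N" "?b \<le> N"
    using card_zeros_ones[where N = N and w = w] by linarith+
  then have "?b * (pi / N) = ?a * (pi / N)"
    by (intro cos_inj_pi[OF _ _ _ _ cos] bounds)
  moreover have "pi / N \<noteq> 0"
    using False by simp
  ultimately show ?thesis
    by (simp only: mult_cancel_right of_nat_eq_iff) simp
qed simp

text \<open>A symmetric product of \<open>card Z > N / 2\<close> copies of one vector \<open>v\<close> contracts \<open>\<psi>\<close> to zero:
  rotating \<open>v\<close> to a multiple of \<open>e 0\<close>, only coefficients of nonzero weight remain. The
  lemma is the case \<open>v = e 0 + e 1\<close>.\<close>

lemma Inv_space_sum_block_eq_0:
  assumes \<psi>: "\<psi> \<in> Inv_space N" and Z: "Z \<subseteq> {1..N}" "N < 2 * card Z" and v: "v \<in> words N"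
  shows "(\<Sum>w\<in>{w \<in> words N. \<forall>i\<in>{1..N} - Z. w i = v i}. \<psi> w) = 0"
proof -
  \<comment> \<open>\<open>u\<close> is a rotation by 45 degrees, whose row 0 is \<open>c\<close>
    times e 0 + e 1.\<close>
  define c where "c = complex_of_real (1 / sqrt 2)"
  define u :: "complex ^ 2 ^ 2"
    where "u = (\<chi> i j. if i = 1 \<and> j = 0 then - c else c)"
  \<comment> \<open>\<open>A\<close> is the identity on \<open>Z\<close>, where \<open>v0\<close>
    selects the letter 0, and the transpose of \<open>u\<close>, hence its inverse, off
    \<open>Z\<close>. After composition with \<open>u\<close>, row 0 of \<open>u\<close> remains on
    \<open>Z\<close> and a Kronecker delta off \<open>Z\<close>.\<close>
  define A where "A i a b = (if i \<in> Z then if a = b then 1 else 0 else u $ b $ a)" for i a b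
  define v0 where "v0 = (\<lambda>i\<in>{1..N}. if i \<in> Z then 0 else v i)"
  have "c * c = of_real (1 / sqrt 2 * (1 / sqrt 2))"
    by (simp only: c_def of_real_mult)
  then have c: "c * c = 1 / 2" "c \<noteq> 0"
    by auto
  have "cnj c = c"
    by (simp add: c_def)
  have c': "2 * (c * c) = 1"
    unfolding c by simp
  with c \<open>cnj c = c\<close> have "u \<in> SU2"
    by (simp add: SU2_def vec_eq_iff forall_2 matrix_matrix_mult_def sum_2 mat_def det_2 two_eq_zero_2 u_def)
  have orth: "(\<Sum>b\<in>UNIV. u $ b $ a * u $ b $ d) = (if a = d then 1 else 0)" for a d
    using index_2_cases[of a] index_2_cases[of d] c' by (auto simp: sum_2 two_eq_zero_2 u_def)
  have A_u: "(\<Sum>b\<in>UNIV. A i (v0 i) b * u $ b $ w i)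
      = (if i \<in> Z then c else if w i = v i then 1 else 0)" if "i \<in> {1..N}" for i w
  proof (cases "i \<in> Z")
    case True
    then show ?thesis
      using that index_2_cases[of "w i"] by (auto simp: A_def v0_def sum_2 two_eq_zero_2 u_def)
  next
    case False
    then show ?thesis
      using that orth[of "v i" "w i"] by (auto simp: A_def v0_def)
  qed
  \<comment> \<open>This contraction of \<open>\<psi>\<close> is computed twice. Directly it is 0,
    since only words that are 0 on all of \<open>Z\<close> can contribute and these are unbalanced;
    with \<open>\<psi>\<close> replaced by its image under \<open>u\<close> it is a nonzero multiple
    of the block sum.\<close>
  have "0 = (\<Sum>w'\<in>words N. (\<Prod>i\<in>{1..N}. A i (v0 i) (w' i)) * \<psi> w')"
  proof (rule sum.neutral[symmetric], rule ballI)
    fix w' assume w': "w' \<in> words N"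
    show "(\<Prod>i\<in>{1..N}. A i (v0 i) (w' i)) * \<psi> w' = 0"
    proof (cases "\<exists>i\<in>Z. w' i \<noteq> 0")
      case True
      then have "\<exists>i\<in>{1..N}. A i (v0 i) (w' i) = 0"
        using Z(1) by (force simp: A_def v0_def)
      then show ?thesis
        by simp
    next
      case False
      then have "card Z \<le> card {i \<in> {1..N}. w' i = 0}"
        using Z(1) by (intro card_mono) auto
      then have "card {i \<in> {1..N}. w' i = 0} \<noteq> card {i \<in> {1..N}. w' i = 1}"
        using card_zeros_ones[of N w'] Z(2) by linarith
      then show ?thesis
        using Inv_space_weight_zero[OF \<psi> w'] by auto
    qed
  qed
  also have "\<dots> = (\<Sum>w'\<in>words N. (\<Prod>i\<in>{1..N}. A i (v0 i) (w' i)) * tensor_act N u \<psi> w')"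
    using \<psi> \<open>u \<in> SU2\<close> by (simp add: Inv_space_def)
  also have "\<dots> = (\<Sum>w'\<in>words N. \<Sum>w\<in>words N. (\<Prod>i\<in>{1..N}. A i (v0 i) (w' i) * u $ w' i $ w i) * \<psi> w)"
    by (intro sum.cong refl) (simp add: tensor_act_def sum_distrib_left prod.distrib mult.assoc)
  also have "\<dots> = (\<Sum>w\<in>words N. (\<Sum>w'\<in>words N. \<Prod>i\<in>{1..N}. A i (v0 i) (w' i) * u $ w' i $ w i) * \<psi> w)"
    by (subst sum.swap) (simp add: sum_distrib_right)
  also have "\<dots> = (\<Sum>w\<in>words N. (\<Prod>i\<in>{1..N}. \<Sum>b\<in>UNIV. A i (v0 i) b * u $ b $ w i) * \<psi> w)"
    unfolding words_def by (subst prod_sum_PiE[symmetric]) simp_all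
  also have "\<dots> = (\<Sum>w\<in>words N. if \<forall>i\<in>{1..N} - Z. w i = v i then c ^ card Z * \<psi> w else 0)"
  proof (intro sum.cong refl)
    fix w
    have "(\<Prod>i\<in>{1..N}. \<Sum>b\<in>UNIV. A i (v0 i) b * u $ b $ w i)
        = (\<Prod>i\<in>{1..N}. if i \<in> Z then c else if w i = v i then 1 else 0)"
      by (intro prod.cong refl A_u)
    also have "\<dots> = (\<Prod>i\<in>Z. c) * (\<Prod>i\<in>{1..N} - Z. if w i = v i then 1 else 0)"
      using Z(1) by (simp add: prod.If_cases Int_absorb1 Diff_eq)
    also have "\<dots> = (if \<forall>i\<in>{1..N} - Z. w i = v i then c ^ card Z else 0)"
      by auto
    finally show "(\<Prod>i\<in>{1..N}. \<Sum>b\<in>UNIV. A i (v0 i) b * u $ b $ w i) * \<psi> w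
        = (if \<forall>i\<in>{1..N} - Z. w i = v i then c ^ card Z * \<psi> w else 0)"
      by simp
  qed
  also have "\<dots> = c ^ card Z * (\<Sum>w\<in>{w \<in> words N. \<forall>i\<in>{1..N} - Z. w i = v i}. \<psi> w)"
    by (simp add: sum.inter_filter sum_distrib_left if_distrib[of "\<lambda>x. c ^ card Z * x"] cong: if_cong)
  finally show ?thesis
    using c(2) by simp
qed

section \<open>Straightening\<close>

definition ones_sum :: "nat \<Rightarrow> (nat \<Rightarrow> 2) \<Rightarrow> nat"
  where "ones_sum N w = (\<Sum>i\<in>{1..N}. if w i = 1 then i else 0)"

lemma ones_sum_le: "ones_sum N w \<le> (\<Sum>i\<in>{1..N}. i)"
  unfolding ones_sum_def by (intro sum_mono) auto

text \<open>Passing from \<open>w\<close> to \<open>w'\<close> moves ones across the threshold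
  \<open>p\<close>. As the numbers of ones agree, positions can be measured from \<open>p\<close>: a
  lost one had contributed at most 0, a gained one contributes more than 0.\<close>

lemma ones_sum_less:
  assumes w: "w \<in> words N" and w': "w' \<in> words N" and "w' \<noteq> w"
    and card: "card {i \<in> {1..N}. w' i = 1} = card {i \<in> {1..N}. w i = 1}"
    and sep: "\<And>i. i \<in> {1..N} \<Longrightarrow> w i \<noteq> w' i \<Longrightarrow> if w i = 1 then i \<le> p else p < i"
  shows "ones_sum N w < ones_sum N w'"
proof -
  let ?h = "\<lambda>w i. if w i = (1 :: 2) then int i - int p else 0"
  have sum_h: "(\<Sum>i\<in>{1..N}. ?h w i) = int (ones_sum N w) - int (card {i \<in> {1..N}. w i = 1}) * int p"
    for w :: "nat \<Rightarrow> 2"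
  proof -
    have "(\<Sum>i\<in>{1..N}. ?h w i)
        = (\<Sum>i\<in>{1..N}. int (if w i = 1 then i else 0)) - (\<Sum>i\<in>{1..N}. if w i = 1 then int p else 0)"
      unfolding sum_subtractf[symmetric] by (intro sum.cong) auto
    also have "(\<Sum>i\<in>{1..N}. if w i = 1 then int p else 0) = (\<Sum>i\<in>{i \<in> {1..N}. w i = 1}. int p)"
      by (rule sum.inter_filter[symmetric]) simp
    finally show ?thesis
      by (simp add: ones_sum_def)
  qed
  \<comment> \<open>Strictness has to come from a gained one, since a lost one may sit at
    \<open>p\<close> itself and count 0.\<close>
  have "\<exists>i\<in>{1..N}. w i \<noteq> 1 \<and> w' i = 1"
  proof (rule ccontr)
    assume "\<not> ?thesis"
    then have "{i \<in> {1..N}. w' i = 1} \<subseteq> {i \<in> {1..N}. w i = 1}"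
      by blast
    then have eq: "{i \<in> {1..N}. w' i = 1} = {i \<in> {1..N}. w i = 1}"
      by (rule card_subset_eq[rotated]) (use card in simp_all)
    have "w' i = w i" if "i \<in> {1..N}" for i
    proof -
      have "w' i = 1 \<longleftrightarrow> w i = 1"
        using eq that by blast
      then show ?thesis
        using index_2_cases[of "w i"] index_2_cases[of "w' i"] by auto
    qed
    then show False
      using words_eq_iff[OF w' w] \<open>w' \<noteq> w\<close> by blast
  qed
  then obtain k where k: "k \<in> {1..N}" "w k \<noteq> 1" "w' k = 1"
    by blast
  have "?h w k < ?h w' k"
    using sep[OF k(1)] k(2,3) by auto
  moreover have "?h w i \<le> ?h w' i" if "i \<in> {1..N}" for i
    using sep[OF that] index_2_cases[of "w i"] index_2_cases[of "w' i"] by auto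
  ultimately have "(\<Sum>i\<in>{1..N}. ?h w i) < (\<Sum>i\<in>{1..N}. ?h w' i)"
    by (intro sum_strict_mono_ex1 finite_atLeastAtMost ballI bexI[of _ k] k(1))
  then show ?thesis
    unfolding sum_h card by simp
qed

text \<open>Sorting the positions of zeros and of ones makes the rows increase automatically, so
  standardness reduces to comparing \<open>z\<close> and \<open>l\<close> in each column.\<close>

lemma tableau_of_word:
  fixes n :: nat and w :: "nat \<Rightarrow> 2"
  defines "z \<equiv> sorted_list_of_set {i \<in> {1..2 * n}. w i = 0}"
    and "l \<equiv> sorted_list_of_set {i \<in> {1..2 * n}. w i = 1}"
  defines "t \<equiv> restrict (\<lambda>(i, j). if i = 0 then z ! j else l ! j) (boxes [n, n])"
  assumes w: "w \<in> words (2 * n)" and len: "length z = n" "length l = n"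
  shows "t \<in> tableaux [n, n]" "row_word n t = w"
    and "\<forall>j<n. z ! j < l ! j \<Longrightarrow> t \<in> standard_tableaux [n, n]"
proof -
  have set: "set z = {i \<in> {1..2 * n}. w i = 0}" "set l = {i \<in> {1..2 * n}. w i = 1}"
    by (simp_all add: z_def l_def)
  have srt: "sorted_wrt (<) z" "sorted_wrt (<) l"
    by (simp_all add: z_def l_def)
  then have dist: "distinct z" "distinct l"
    by (simp_all add: z_def l_def)
  have t: "t (0, j) = z ! j" "t (1, j) = l ! j" if "j < n" for j
    using that by (simp_all add: t_def boxes_two_rows)
  have z_l: "z ! j \<in> {1..2 * n}" "w (z ! j) = 0" "l ! j \<in> {1..2 * n}" "w (l ! j) = 1" if "j < n" for j
    using nth_mem[of j z] nth_mem[of j l] that len unfolding set by simp_all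
  have "inj_on t ({0, 1} \<times> {..<n})"
  proof (rule inj_onI)
    fix x y assume "x \<in> {0, 1} \<times> {..<n}" "y \<in> {0, 1} \<times> {..<n}" "t x = t y"
    then show "x = y"
      using t z_l dist len nth_eq_iff_index_eq[of z] nth_eq_iff_index_eq[of l]
      by (auto; metis zero_neq_one)
  qed
  moreover have "t ` ({0, 1} \<times> {..<n}) = {1..2 * n}"
  proof -
    have "t ` ({0, 1} \<times> {..<n}) = (\<lambda>j. t (0, j)) ` {..<n} \<union> (\<lambda>j. t (1, j)) ` {..<n}"
      by auto
    also have "\<dots> = (!) z ` {..<n} \<union> (!) l ` {..<n}"
      using t by simp
    also have "\<dots> = set z \<union> set l"
      using len nth_image[of n z] nth_image[of n l] by (simp add: lessThan_atLeast0)
    also have "\<dots> = {1..2 * n}"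
      unfolding set using index_2_cases by auto
    finally show ?thesis .
  qed
  ultimately show tab: "t \<in> tableaux [n, n]"
    unfolding tableaux_def boxes_two_rows by (simp add: bij_betw_def t_def boxes_two_rows mult_2)
  then interpret two_row_tableau n t
    by unfold_locales
  show "row_word n t = w"
  proof (rule words_eqI[OF row_word_in_words w])
    fix j assume j: "j < n"
    show "row_word n t (t (0, j)) = w (t (0, j))"
      using row_word_upper[OF j] t(1)[OF j] z_l(2)[OF j] by simp
    show "row_word n t (t (1, j)) = w (t (1, j))"
      using row_word_lower[OF j] t(2)[OF j] z_l(4)[OF j] by simp
  qed
  show "t \<in> standard_tableaux [n, n]" if "\<forall>j<n. z ! j < l ! j"
  proof -
    have "t (i, j) < t (i, j')" if "i \<in> {0, 1}" "j < n" "j' < n" "j < j'" for i j j'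
      using that t sorted_wrt_nth_less[OF srt(1), of j j'] sorted_wrt_nth_less[OF srt(2), of j j'] len
      by auto
    moreover have "t (0, j) < t (1, j)" if "j < n" for j
      using that t \<open>\<forall>j<n. z ! j < l ! j\<close> by simp
    ultimately show ?thesis
      using tab by (auto simp: standard_tableaux_def boxes_two_rows)
  qed
qed

text \<open>Garnir's argument: if the zeros \<open>z\<close> and the ones \<open>l\<close> of \<open>w\<close> do not form a standard tableau,
  say \<open>l ! j < z ! j\<close>, then the \<open>n + 1\<close> positions \<open>l ! 0, \<dots>, l ! j, z ! j, \<dots>, z ! (n - 1)\<close>
  give a relation expressing \<open>\<psi> w\<close> by values at words whose ones lie further to the right.\<close>

lemma Inv_space_eq_0:
  assumes \<psi>: "\<psi> \<in> Inv_space (2 * n)"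
    and 0: "\<And>t. t \<in> standard_tableaux [n, n] \<Longrightarrow> \<psi> (row_word n t) = 0"
  shows "\<psi> = 0"
proof
  fix w
  show "\<psi> w = 0 w"
  \<comment> \<open>The measure drops as the ones move right; \<open>ones_sum_le\<close> keeps the
    truncated subtraction faithful.\<close>
  proof (induction "(\<Sum>i\<in>{1..2 * n}. i) - ones_sum (2 * n) w" arbitrary: w rule: less_induct)
    case less
    define z where "z = sorted_list_of_set {i \<in> {1..2 * n}. w i = 0}"
    define l where "l = sorted_list_of_set {i \<in> {1..2 * n}. w i = 1}"
    define t where "t = restrict (\<lambda>(i, j). if i = 0 then z ! j else l ! j) (boxes [n, n])"
    have "\<psi> w = 0"
    proof (rule ccontr)
      assume "\<psi> w \<noteq> 0"
      then have w: "w \<in> words (2 * n)"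
        using \<psi> by (auto simp: Inv_space_def tensors_def)
      have balanced: "card {i \<in> {1..2 * n}. v i = 0} = n \<and> card {i \<in> {1..2 * n}. v i = 1} = n"
        if "v \<in> words (2 * n)" "\<psi> v \<noteq> 0" for v
        using Inv_space_weight_zero[OF \<psi> that] card_zeros_ones[of "2 * n" v] by linarith
      then have len: "length z = n" "length l = n"
        using w \<open>\<psi> w \<noteq> 0\<close> by (simp_all add: z_def l_def del: atLeastAtMost_iff)
      note tab = tableau_of_word[OF w len[unfolded z_def l_def], folded z_def l_def, folded t_def]
      \<comment> \<open>As \<open>\<psi>\<close> vanishes at row words of standard tableaux,
        \<open>t\<close> must violate the column condition; equality is excluded below because the
        letters differ.\<close>
      obtain j where j: "j < n" "l ! j \<le> z ! j"
        using 0[OF tab(3)] tab(2) \<open>\<psi> w \<noteq> 0\<close> by (metis not_le)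
      have set: "set z = {i \<in> {1..2 * n}. w i = 0}" "set l = {i \<in> {1..2 * n}. w i = 1}"
        by (simp_all add: z_def l_def)
      have srt: "sorted_wrt (<) z" "sorted_wrt (<) l"
        by (simp_all add: z_def l_def)
      then have dist: "distinct z" "distinct l"
        by (simp_all add: z_def l_def)
      have z_in: "z ! k \<in> {1..2 * n} \<and> w (z ! k) = 0" if "k < n" for k
        using nth_mem[of k z] that len unfolding set by simp
      have l_in: "l ! k \<in> {1..2 * n} \<and> w (l ! k) = 1" if "k < n" for k
        using nth_mem[of k l] that len unfolding set by simp
      have "l ! j \<noteq> z ! j"
        using z_in[OF j(1)] l_in[OF j(1)] by auto
      \<comment> \<open>\<open>X\<close> holds j + 1 ones at positions up to \<open>l ! j\<close>
        and \<open>Y\<close> holds n - j zeros strictly beyond it: together n + 1 positions, more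
        than half, as the block relation requires.\<close>
      define X where "X = (!) l ` {..j}"
      define Y where "Y = (!) z ` {j..<n}"
      have X: "i \<in> {1..2 * n} \<and> w i = 1 \<and> i \<le> l ! j" if i: "i \<in> X" for i
      proof -
        obtain k where k: "k \<le> j" "i = l ! k"
          using i by (auto simp: X_def)
        then have "l ! k \<le> l ! j"
          using sorted_wrt_nth_less[OF srt(2), of k j] j len by (cases "k = j") auto
        then show ?thesis
          using k j l_in[of k] by simp
      qed
      have Y: "i \<in> {1..2 * n} \<and> w i = 0 \<and> l ! j < i" if i: "i \<in> Y" for i
      proof -
        obtain k where k: "j \<le> k" "k < n" "i = z ! k"
          using i by (auto simp: Y_def)
        then have "z ! j \<le> z ! k"
          using sorted_wrt_nth_less[OF srt(1), of j k] len by (cases "k = j") auto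
        then show ?thesis
          using k j z_in[of k] \<open>l ! j \<noteq> z ! j\<close> by simp
      qed
      have "card X = j + 1" "card Y = n - j"
        unfolding X_def Y_def using dist len j by (subst card_image; auto intro!: inj_on_nth)+
      moreover have "X \<inter> Y = {}"
        using X Y by fastforce
      ultimately have "card (X \<union> Y) = n + 1"
        using j by (subst card_Un_disjoint) (auto simp: X_def Y_def)
      let ?S = "{v \<in> words (2 * n). \<forall>i\<in>{1..2 * n} - (X \<union> Y). v i = w i}"
      have "(\<Sum>v\<in>?S. \<psi> v) = 0"
        by (rule Inv_space_sum_block_eq_0[OF \<psi> _ _ w])
          (use X Y \<open>card (X \<union> Y) = n + 1\<close> in auto)
      moreover have "(\<Sum>v\<in>?S. \<psi> v) = \<psi> w + (\<Sum>v\<in>?S - {w}. \<psi> v)"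
        using w by (intro sum.remove) simp_all
      moreover have "(\<Sum>v\<in>?S - {w}. \<psi> v) = 0"
      proof (rule sum.neutral, rule ballI, rule ccontr)
        fix v assume v: "v \<in> ?S - {w}" "\<psi> v \<noteq> 0"
        then have v': "v \<in> words (2 * n)" "v \<noteq> w"
          and off: "\<And>i. i \<in> {1..2 * n} \<Longrightarrow> i \<notin> X \<Longrightarrow> i \<notin> Y \<Longrightarrow> v i = w i"
          by blast+
        \<comment> \<open>A further word with nonzero value is balanced too and differs from
          \<open>w\<close> only by losing ones in \<open>X\<close> and gaining ones in
          \<open>Y\<close>, so \<open>l ! j\<close> is a valid threshold.\<close>
        have "ones_sum (2 * n) w < ones_sum (2 * n) v"
        proof (rule ones_sum_less[where p = "l ! j"])
          show "card {i \<in> {1..2 * n}. v i = 1} = card {i \<in> {1..2 * n}. w i = 1}"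
            using balanced[OF v'(1) v(2)] balanced[OF w \<open>\<psi> w \<noteq> 0\<close>] by presburger
          show "if w i = 1 then i \<le> l ! j else l ! j < i" if "i \<in> {1..2 * n}" "w i \<noteq> v i" for i
          proof -
            have "i \<in> X \<or> i \<in> Y"
              using off[of i] that by metis
            then show ?thesis
              using X[of i] Y[of i] by auto
          qed
        qed (use v' w in simp_all)
        then have "(\<Sum>i\<in>{1..2 * n}. i) - ones_sum (2 * n) v < (\<Sum>i\<in>{1..2 * n}. i) - ones_sum (2 * n) w"
          using ones_sum_le[of "2 * n" v] by linarith
        then show False
          using less v(2) by (metis zero_fun_apply)
      qed
      ultimately show False
        using \<open>\<psi> w \<noteq> 0\<close> by simp
    qed
    then show ?case
      by simp
  qed
qed

section \<open>Unitriangularity of the evaluation matrix\<close>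

lemma standard_tableau_columns:
  assumes "t \<in> standard_tableaux [n, n]" "j < n"
  shows "t (0, j) < t (1, j)"
  using assms by (auto simp: standard_tableaux_def boxes_two_rows)

text \<open>A nonzero value requires exactly one 1 per column. In a standard tableau the lower entry
  is larger, so the sum of positions is greatest when all ones lie below.\<close>

lemma singlets_triangular:
  assumes t: "t \<in> standard_tableaux [n, n]" and "singlets n t w \<noteq> 0"
  shows "w = row_word n t \<or> ones_sum (2 * n) w < ones_sum (2 * n) (row_word n t)"
proof -
  interpret two_row_tableau n t
    using t by unfold_locales (simp add: standard_tableaux_def)
  have w: "w \<in> words (2 * n)" and ne: "\<And>j. j < n \<Longrightarrow> w (t (0, j)) \<noteq> w (t (1, j))"
    using assms(2) by (auto simp: singlets_def eps_def split: if_splits)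
  let ?h = "\<lambda>w j. (if w (t (0, j)) = (1 :: 2) then t (0, j) else 0) + (if w (t (1, j)) = (1 :: 2) then t (1, j) else 0)"
  have sum_h: "ones_sum (2 * n) w = (\<Sum>j<n. ?h w j)" for w
    unfolding ones_sum_def by (rule sum_entries)
  have h: "?h w j \<le> ?h (row_word n t) j"
    "w (t (0, j)) = 1 \<Longrightarrow> ?h w j < ?h (row_word n t) j" if "j < n" for j
    using that ne[OF that] standard_tableau_columns[OF t that]
      index_2_cases[of "w (t (0, j))"] index_2_cases[of "w (t (1, j))"]
    by auto
  show ?thesis
  proof (cases "\<exists>j<n. w (t (0, j)) = 1")
    case True
    then obtain k where "k < n" "w (t (0, k)) = 1"
      by blast
    then have "(\<Sum>j<n. ?h w j) < (\<Sum>j<n. ?h (row_word n t) j)"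
      using h by (intro sum_strict_mono_ex1 bexI[of _ k] ballI) (simp_all only: lessThan_iff finite_lessThan)
    then show ?thesis
      unfolding sum_h by blast
  next
    case False
    have "w = row_word n t"
    proof (rule words_eqI[OF w row_word_in_words])
      show "w (t (0, j)) = row_word n t (t (0, j))" if "j < n" for j
        using that False index_2_cases[of "w (t (0, j))"] by auto
      show "w (t (1, j)) = row_word n t (t (1, j))" if "j < n" for j
        using that False ne[OF that] index_2_cases[of "w (t (0, j))"] index_2_cases[of "w (t (1, j))"]
        by auto
    qed
    then show ?thesis ..
  qed
qed

text \<open>Each row of a standard tableau increases and is therefore recovered as the sorted list
  of the positions of its letter.\<close>

lemma row_word_inj:
  assumes "s \<in> standard_tableaux [n, n]" "t \<in> standard_tableaux [n, n]" "row_word n s = row_word n t"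
  shows "s = t"
proof -
  have row: "map (\<lambda>j. t (i, j)) [0..<n] = sorted_list_of_set {k \<in> {1..2 * n}. row_word n t k = of_nat i}"
    if t: "t \<in> standard_tableaux [n, n]" and i: "i \<in> {0, 1}" for t i
  proof -
    interpret two_row_tableau n t
      using t by unfold_locales (simp add: standard_tableaux_def)
    have "sorted_wrt (<) (map (\<lambda>j. t (i, j)) [0..<n])"
      using t i by (auto simp: sorted_wrt_iff_nth_less standard_tableaux_def boxes_two_rows)
    moreover have "set (map (\<lambda>j. t (i, j)) [0..<n]) = {k \<in> {1..2 * n}. row_word n t k = of_nat i}"
    proof
      show "set (map (\<lambda>j. t (i, j)) [0..<n]) \<subseteq> {k \<in> {1..2 * n}. row_word n t k = of_nat i}"
        using i entry_in by auto
      show "{k \<in> {1..2 * n}. row_word n t k = of_nat i} \<subseteq> set (map (\<lambda>j. t (i, j)) [0..<n])"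
      proof
        fix k assume k: "k \<in> {k \<in> {1..2 * n}. row_word n t k = of_nat i}"
        then have "k \<in> {1..2 * n}"
          by simp
        then show "k \<in> set (map (\<lambda>j. t (i, j)) [0..<n])"
          by (rule entry_cases) (use i k in auto)
      qed
    qed
    ultimately show ?thesis
      by (intro strict_sorted_equal) simp_all
  qed
  have "s (i, j) = t (i, j)" if "i \<in> {0, 1}" "j < n" for i j
  proof -
    have "map (\<lambda>j. s (i, j)) [0..<n] = map (\<lambda>j. t (i, j)) [0..<n]"
      using assms that by (simp only: row)
    then show ?thesis
      using that(2) by simp
  qed
  then show ?thesis
    using assms
    by (intro extensionalityI[of s "boxes [n, n]" t])
      (auto simp: standard_tableaux_def tableaux_def boxes_two_rows)
qed

section \<open>The decomposition\<close>

lemma canonical_tableau_in_tableaux: "canonical_tableau [n, n] \<in> tableaux [n, n]"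
proof -
  let ?t = "canonical_tableau [n, n]"
  have t: "?t (0, j) = j + 1" "?t (1, j) = n + j + 1" if "j < n" for j
    using that by (simp_all add: canonical_tableau_def boxes_two_rows)
  have "bij_betw ?t ({0, 1} \<times> {..<n}) {1..2 * n}"
  proof (rule bij_betwI[of _ _ _ "\<lambda>k. if k \<le> n then (0, k - 1) else (1, k - n - 1)"])
    show "?t \<in> {0, 1} \<times> {..<n} \<rightarrow> {1..2 * n}"
      using t by auto
    show "(\<lambda>k. if k \<le> n then (0, k - 1) else (1, k - n - 1)) \<in> {1..2 * n} \<rightarrow> {0, 1} \<times> {..<n}"
      by auto
  qed (use t in \<open>auto split: if_splits\<close>)
  then show ?thesis
    by (simp add: tableaux_def boxes_two_rows mult_2 canonical_tableau_def)
qed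

text \<open>The finite spanning set excludes an infinite basis, whose cardinality would be 0 by
  convention.\<close>

lemma dim_neq_0:
  assumes "finite B" "V \<subseteq> cfun.span B" "x \<in> V" "x \<noteq> 0"
  shows "cfun.dim V \<noteq> 0"
proof -
  obtain C where C: "C \<subseteq> V" "cfun.independent C" "V \<subseteq> cfun.span C" "card C = cfun.dim V"
    using cfun.basis_exists by blast
  have "finite C"
    using cfun.independent_span_bound[OF assms(1) C(2)] C(1) assms(2) by blast
  moreover have "C \<noteq> {}"
    using C(3) assms(3,4) by auto
  ultimately show ?thesis
    using C(4) by auto
qed

lemma group_algebra_subset_span: "group_algebra N \<subseteq> cfun.span (gbasis ` Sym N)"
proof
  fix x assume x: "x \<in> group_algebra N"
  have "x = (\<Sum>g\<in>Sym N. x g *\<^sub>c gbasis g)"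
  proof
    fix h
    have "(\<Sum>g\<in>Sym N. x g *\<^sub>c gbasis g) h = (\<Sum>g\<in>Sym N. if g = h then x g else 0)"
      unfolding sum_fun_apply by (intro sum.cong) (auto simp: cscale_def gbasis_def)
    also have "\<dots> = x h"
      using x by (auto simp: group_algebra_def)
    finally show "x h = (\<Sum>g\<in>Sym N. x g *\<^sub>c gbasis g) h" ..
  qed
  also have "\<dots> \<in> cfun.span (gbasis ` Sym N)"
    by (intro cfun.span_sum cfun.span_scale cfun.span_base imageI)
  finally show "x \<in> cfun.span (gbasis ` Sym N)" .
qed

text \<open>Makes the scalar in \<open>young_idempotent\<close> nonzero. The module contains the
  symmetrizer, as its product with the unit, and the symmetrizer is nonzero because it acts
  nontrivially on the singlets.\<close>

lemma dim_specht_module_neq_0: "cfun.dim (specht_module [n, n]) \<noteq> 0"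
proof (rule dim_neq_0)
  interpret two_row_tableau n "canonical_tableau [n, n]"
    by unfold_locales (rule canonical_tableau_in_tableaux)
  let ?c = "young_symmetrizer [n, n] (canonical_tableau [n, n])"
  show "specht_module [n, n] \<subseteq> cfun.span (gbasis ` Sym (2 * n))"
    using group_algebra_subset_span[of "2 * n"] gmult_in_group_algebra[of "2 * n"]
    by (auto simp: specht_module_def mult_2)
  have "?c \<in> group_algebra (2 * n)"
    by (simp add: young_symmetrizer_def gmult_in_group_algebra mult_2)
  then have "?c = gmult (2 * n) (gbasis id) ?c"
    by (simp add: gmult_gbasis_id)
  moreover have "gbasis id \<in> group_algebra (2 * n)"
    by (auto simp: group_algebra_def gbasis_def)
  ultimately show "?c \<in> specht_module [n, n]"
    by (auto simp: specht_module_def mult_2)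
  show "?c \<noteq> 0"
    using singlets_young_symmetrizer_neq_0 by (auto simp: galg_act_def)
qed simp

section \<open>The lines of singlets as irreducible modules\<close>

context two_row_tableau
begin

lemma singlets_neq_0: "singlets n t \<noteq> 0"
  using singlets_row_word by auto

text \<open>The symmetrizer maps into this line; conversely \<open>singlets n t\<close> is itself
  invariant and an eigenvector with nonzero eigenvalue, so the whole line is reached.\<close>

lemma Inv_tableau_eq: "Inv_tableau [n, n] t = range (\<lambda>c. c *\<^sub>c singlets n t)"
proof -
  let ?e = "young_symmetrizer [n, n] t"
  define k :: complex where "k = of_nat (cfun.dim (specht_module [n, n])) / fact (2 * n)"
  have "k \<noteq> 0"
    using dim_specht_module_neq_0 by (simp add: k_def)
  have eq: "Inv_tableau [n, n] t = (\<lambda>\<psi>. k *\<^sub>c galg_act (2 * n) \<psi> ?e) ` Inv_space (2 * n)"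
    by (simp add: Inv_tableau_def young_idempotent_def galg_act_scale k_def mult_2)
  obtain d where d: "galg_act (2 * n) (singlets n t) ?e = d *\<^sub>c singlets n t"
    using galg_act_young_symmetrizer[OF singlets_in_tensors] by blast
  then have "d \<noteq> 0"
    using singlets_young_symmetrizer_neq_0 by auto
  show ?thesis
  proof
    show "Inv_tableau [n, n] t \<subseteq> range (\<lambda>c. c *\<^sub>c singlets n t)"
    proof
      fix \<phi> assume "\<phi> \<in> Inv_tableau [n, n] t"
      then obtain \<psi> where \<psi>: "\<psi> \<in> Inv_space (2 * n)" "\<phi> = k *\<^sub>c galg_act (2 * n) \<psi> ?e"
        by (auto simp: eq)
      then obtain c where "galg_act (2 * n) \<psi> ?e = c *\<^sub>c singlets n t"
        using galg_act_young_symmetrizer[of \<psi>] by (auto simp: Inv_space_def)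
      then have "\<phi> = (k * c) *\<^sub>c singlets n t"
        by (simp add: \<psi>(2))
      then show "\<phi> \<in> range (\<lambda>c. c *\<^sub>c singlets n t)"
        by blast
    qed
    show "range (\<lambda>c. c *\<^sub>c singlets n t) \<subseteq> Inv_tableau [n, n] t"
    proof (rule image_subsetI)
      fix c
      \<comment> \<open>The denominator cancels the scalar \<open>k\<close> of the idempotent and
        the eigenvalue \<open>d\<close> of the symmetrizer.\<close>
      let ?\<psi> = "(c / (k * d)) *\<^sub>c singlets n t"
      have "galg_act (2 * n) ?\<psi> ?e = (c / (k * d)) *\<^sub>c galg_act (2 * n) (singlets n t) ?e"
        by (rule ext) (simp add: galg_act_apply cscale_def sum_distrib_left ac_simps)
      then have "c *\<^sub>c singlets n t = k *\<^sub>c galg_act (2 * n) ?\<psi> ?e"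
        using \<open>k \<noteq> 0\<close> \<open>d \<noteq> 0\<close> by (simp add: d)
      moreover have "?\<psi> \<in> Inv_space (2 * n)"
        by (intro cfun.subspace_scale subspace_Inv_space singlets_in_Inv_space)
      ultimately show "c *\<^sub>c singlets n t \<in> Inv_tableau [n, n] t"
        unfolding eq by blast
    qed
  qed
qed

lemma Inv_tableau_eq_span: "Inv_tableau [n, n] t = cfun.span {singlets n t}"
  by (simp add: Inv_tableau_eq cfun.span_singleton)

lemma subspace_Inv_tableau: "cfun.subspace (Inv_tableau [n, n] t)"
  by (simp add: Inv_tableau_eq_span)

lemma Inv_tableau_subset: "Inv_tableau [n, n] t \<subseteq> Inv_space (2 * n)"
  unfolding Inv_tableau_eq by (auto intro: cfun.subspace_scale subspace_Inv_space singlets_in_Inv_space)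

lemma dim_Inv_tableau: "cfun.dim (Inv_tableau [n, n] t) = 1"
proof -
  have ind: "cfun.independent {singlets n t}"
    using singlets_neq_0 by simp
  then show ?thesis
    unfolding Inv_tableau_eq_span cfun.dim_span cfun.dim_eq_card_independent[OF ind] by simp
qed

text \<open>An element of the commutant preserves antisymmetry under column swaps, which determines
  the singlets up to a scalar.\<close>

lemma B_alg_singlets:
  assumes "f \<in> B_alg (2 * n)"
  shows "\<exists>c. f (singlets n t) = c *\<^sub>c singlets n t"
proof -
  let ?s = "singlets n t"
  have f: "f ?s \<in> Inv_space (2 * n)" "f ((- 1) *\<^sub>c ?s) = (- 1) *\<^sub>c f ?s"
    "\<And>\<sigma>. \<sigma> \<in> Sym (2 * n) \<Longrightarrow> f (perm_act ?s \<sigma>) = perm_act (f ?s) \<sigma>"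
    using assms singlets_in_Inv_space unfolding B_alg_def by blast+
  have "antisymmetric (f ?s)"
    unfolding antisymmetric_def
  proof (intro conjI allI impI)
    show "f ?s \<in> tensors (2 * n)"
      using f(1) by (simp add: Inv_space_def)
    fix j w assume j: "j < n"
    have "perm_act ?s (col_swap j) = (- 1) *\<^sub>c ?s"
      using antisymmetric_singlets j
      by (simp add: perm_act_def inv_col_swap antisymmetric_def cscale_def)
    then have "perm_act (f ?s) (col_swap j) = (- 1) *\<^sub>c f ?s"
      using f(2) f(3)[OF col_swap_in_Sym[OF j]] by simp
    from fun_cong[OF this, of w] show "f ?s (w \<circ> col_swap j) = - f ?s w"
      by (simp add: perm_act_def inv_col_swap cscale_def)
  qed
  then show ?thesis
    using antisymmetric_eq_singlets by blast
qed

text \<open>The commutant acts on the line by scalars, and a nonzero submodule contains a nonzero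
  multiple of the singlets, hence the line.\<close>

lemma B_irreducible_Inv_tableau: "B_irreducible (2 * n) (Inv_tableau [n, n] t)"
  unfolding B_irreducible_def
proof (intro conjI allI impI)
  show "B_submodule (2 * n) (Inv_tableau [n, n] t)"
    unfolding B_submodule_def
  proof (intro conjI ballI Inv_tableau_subset subspace_Inv_tableau)
    fix f assume f: "f \<in> B_alg (2 * n)"
    then obtain d where d: "f (singlets n t) = d *\<^sub>c singlets n t"
      using B_alg_singlets by blast
    have "f (c *\<^sub>c singlets n t) = (c * d) *\<^sub>c singlets n t" for c
      using f singlets_in_Inv_space d by (simp add: B_alg_def)
    then show "f ` Inv_tableau [n, n] t \<subseteq> Inv_tableau [n, n] t"
      unfolding Inv_tableau_eq by auto
  qed
  have "singlets n t \<in> Inv_tableau [n, n] t"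
    unfolding Inv_tableau_eq_span by (simp add: cfun.span_base)
  then show "Inv_tableau [n, n] t \<noteq> {0}"
    using singlets_neq_0 by auto
  fix U assume U: "B_submodule (2 * n) U \<and> U \<subseteq> Inv_tableau [n, n] t"
  then have sub: "cfun.subspace U"
    by (simp add: B_submodule_def)
  show "U = {0} \<or> U = Inv_tableau [n, n] t"
  proof (rule disjCI)
    assume "U \<noteq> Inv_tableau [n, n] t"
    have "\<psi> = 0" if mem: "\<psi> \<in> U" for \<psi>
    proof (rule ccontr)
      assume "\<psi> \<noteq> 0"
      obtain c where c: "\<psi> = c *\<^sub>c singlets n t"
        using mem U unfolding Inv_tableau_eq by blast
      then have "c \<noteq> 0"
        using \<open>\<psi> \<noteq> 0\<close> by auto
      then have "(d / c) *\<^sub>c \<psi> = d *\<^sub>c singlets n t" for d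
        by (simp add: c)
      then have "Inv_tableau [n, n] t \<subseteq> U"
        unfolding Inv_tableau_eq using cfun.subspace_scale[OF sub mem] by (metis image_subsetI)
      then show False
        using U \<open>U \<noteq> Inv_tableau [n, n] t\<close> by blast
    qed
    then show "U = {0}"
      using cfun.subspace_0[OF sub] by blast
  qed
qed

end

section \<open>The singlet products as a basis of the invariants\<close>

lemma standard_two_row_tableau: "t \<in> standard_tableaux [n, n] \<Longrightarrow> two_row_tableau n t"
  by unfold_locales (simp add: standard_tableaux_def)

lemma finite_standard_tableaux: "finite (standard_tableaux \<mu>)"
proof (rule finite_subset)
  have "boxes \<mu> = (SIGMA i:{..<length \<mu>}. {..<\<mu> ! i})"
    by (auto simp: boxes_def)
  then show "finite (boxes \<mu> \<rightarrow>\<^sub>E {1..sum_list \<mu>})"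
    by (intro finite_PiE) simp_all
  show "standard_tableaux \<mu> \<subseteq> boxes \<mu> \<rightarrow>\<^sub>E {1..sum_list \<mu>}"
  proof
    fix t assume "t \<in> standard_tableaux \<mu>"
    then have "t \<in> extensional (boxes \<mu>)" "bij_betw t (boxes \<mu>) {1..sum_list \<mu>}"
      by (simp_all add: standard_tableaux_def tableaux_def)
    then show "t \<in> boxes \<mu> \<rightarrow>\<^sub>E {1..sum_list \<mu>}"
      unfolding PiE_iff using bij_betwE by blast
  qed
qed

lemma singlets_row_word_neq_0:
  assumes "s \<in> standard_tableaux [n, n]" "t \<in> standard_tableaux [n, n]"
    and "singlets n t (row_word n s) \<noteq> 0" "s \<noteq> t"
  shows "ones_sum (2 * n) (row_word n s) < ones_sum (2 * n) (row_word n t)"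
  using singlets_triangular[OF assms(2,3)] row_word_inj[OF assms(1,2)] assms(4) by blast

text \<open>Triangular elimination over a set \<open>A\<close> closed downwards in
  \<open>ones_sum\<close>. Subtracting a multiple of \<open>singlets n t\<close> for a maximal
  \<open>t\<close> clears the value at \<open>row_word n t\<close> and otherwise disturbs only row
  words with smaller sum, whose tableaux lie in \<open>A\<close>. The induction ends with
  \<open>Inv_space_eq_0\<close>.\<close>

lemma Inv_space_expansion:
  assumes "\<psi> \<in> Inv_space (2 * n)" "A \<subseteq> standard_tableaux [n, n]"
    and "\<And>s. s \<in> standard_tableaux [n, n] \<Longrightarrow> \<psi> (row_word n s) \<noteq> 0 \<Longrightarrow> s \<in> A"
    and "\<And>s t. s \<in> standard_tableaux [n, n] \<Longrightarrow> t \<in> A \<Longrightarrow>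
      ones_sum (2 * n) (row_word n s) < ones_sum (2 * n) (row_word n t) \<Longrightarrow> s \<in> A"
  shows "\<exists>c. \<psi> = (\<Sum>t\<in>A. c t *\<^sub>c singlets n t)"
  using assms
proof (induction "card A" arbitrary: A \<psi>)
  case 0
  then have "A = {}"
    using finite_subset[OF "0.prems"(2) finite_standard_tableaux] by simp
  then show ?case
    using Inv_space_eq_0[OF "0.prems"(1)] "0.prems"(3) by (simp add: zero_fun_def[symmetric]) blast
next
  case (Suc m)
  let ?f = "\<lambda>t. ones_sum (2 * n) (row_word n t)"
  have fin: "finite A" "A \<noteq> {}"
    using Suc.hyps(2) card.infinite by fastforce+
  then obtain t where t: "t \<in> A" "\<And>s. s \<in> A \<Longrightarrow> ?f s \<le> ?f t"
    using obtains_MAX[OF fin, of ?f] fin(1) by (metis Max_ge finite_imageI imageI)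
  then have std: "t \<in> standard_tableaux [n, n]"
    using Suc.prems(2) by blast
  interpret two_row_tableau n t
    using std by (rule standard_two_row_tableau)
  define \<phi> where "\<phi> = \<psi> - \<psi> (row_word n t) *\<^sub>c singlets n t"
  have "\<exists>c. \<phi> = (\<Sum>t\<in>A - {t}. c t *\<^sub>c singlets n t)"
  proof (rule Suc.hyps(1))
    show "m = card (A - {t})"
      using Suc.hyps(2) t(1) fin by simp
    show "\<phi> \<in> Inv_space (2 * n)"
      unfolding \<phi>_def
      by (intro cfun.subspace_diff cfun.subspace_scale subspace_Inv_space singlets_in_Inv_space Suc.prems(1))
    show "s \<in> A - {t}" if s: "s \<in> standard_tableaux [n, n]" "\<phi> (row_word n s) \<noteq> 0" for s
    proof -
      have "s \<noteq> t"
        using s(2) singlets_row_word by (auto simp: \<phi>_def cscale_def)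
      moreover have "\<psi> (row_word n s) \<noteq> 0 \<or> singlets n t (row_word n s) \<noteq> 0"
        using s(2) by (auto simp: \<phi>_def cscale_def)
      ultimately show ?thesis
        using Suc.prems(3)[OF s(1)] Suc.prems(4)[OF s(1) t(1)] singlets_row_word_neq_0[OF s(1) std]
        by blast
    qed
    \<comment> \<open>Closure survives the removal: by maximality, \<open>t\<close> is not strictly
      below any member of \<open>A\<close>.\<close>
    show "s \<in> A - {t}" if "s \<in> standard_tableaux [n, n]" "r \<in> A - {t}" "?f s < ?f r" for s r
      using Suc.prems(4)[OF that(1) _ that(3)] that(2,3) t(2)[of r] by auto
  qed (use Suc.prems(2) in blast)
  then obtain c where c: "\<phi> = (\<Sum>t\<in>A - {t}. c t *\<^sub>c singlets n t)"
    by blast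
  let ?c = "c(t := \<psi> (row_word n t))"
  have "\<psi> = \<psi> (row_word n t) *\<^sub>c singlets n t + \<phi>"
    by (simp add: \<phi>_def)
  also have "\<dots> = ?c t *\<^sub>c singlets n t + (\<Sum>t\<in>A - {t}. ?c t *\<^sub>c singlets n t)"
    unfolding c by (intro arg_cong2[where f = "(+)"] sum.cong) simp_all
  also have "\<dots> = (\<Sum>t\<in>A. ?c t *\<^sub>c singlets n t)"
    using fin(1) t(1) by (rule sum.remove[symmetric])
  finally show ?case
    by (intro exI[of _ ?c])
qed

text \<open>Evaluate at the row word of a tableau \<open>s\<close> maximizing
  \<open>ones_sum\<close> among those with nonzero coefficient. Any other contributing tableau would
  have a larger sum, so only \<open>c s\<close> survives.\<close>

lemma singlets_independent:
  assumes "(\<Sum>t\<in>standard_tableaux [n, n]. c t *\<^sub>c singlets n t) = 0" "t \<in> standard_tableaux [n, n]"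
  shows "c t = 0"
proof (rule ccontr)
  assume "c t \<noteq> 0"
  let ?I = "standard_tableaux [n, n]"
  let ?J = "{t \<in> ?I. c t \<noteq> 0}"
  let ?f = "\<lambda>t. ones_sum (2 * n) (row_word n t)"
  have "finite ?J" "?J \<noteq> {}"
    using finite_standard_tableaux \<open>c t \<noteq> 0\<close> assms(2) by auto
  then obtain s where s: "s \<in> ?J" "\<And>t. t \<in> ?J \<Longrightarrow> ?f t \<le> ?f s"
    using obtains_MAX[of ?J ?f] by (metis (no_types, lifting) Max_ge finite_imageI imageI)
  interpret two_row_tableau n s
    using s(1) by (intro standard_two_row_tableau) simp
  have "0 = (\<Sum>t\<in>?I. c t *\<^sub>c singlets n t) (row_word n s)"
    using assms(1) by simp
  also have "\<dots> = (\<Sum>t\<in>?I. if t = s then c s else 0)"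
    unfolding sum_fun_apply
  proof (intro sum.cong refl)
    fix t assume t: "t \<in> ?I"
    show "(c t *\<^sub>c singlets n t) (row_word n s) = (if t = s then c s else 0)"
    proof (cases "t = s")
      case False
      then have "c t = 0 \<or> singlets n t (row_word n s) = 0"
        using singlets_row_word_neq_0[of s n t] s(1) s(2)[of t] t by fastforce
      then show ?thesis
        using False by (auto simp: cscale_def)
    qed (simp add: cscale_def singlets_row_word)
  qed
  also have "\<dots> = c s"
    using s(1) finite_standard_tableaux by simp
  finally show False
    using s(1) by simp
qed

lemma is_direct_sum_Inv_space:
  "is_direct_sum (Inv_space (2 * n)) (standard_tableaux [n, n]) (Inv_tableau [n, n])"
  unfolding is_direct_sum_def
proof (intro conjI ballI impI finite_standard_tableaux)
  let ?I = "standard_tableaux [n, n]"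
  show "cfun.subspace (Inv_tableau [n, n] t)" if "t \<in> ?I" for t
    using two_row_tableau.subspace_Inv_tableau[OF standard_two_row_tableau[OF that]] .
  have W: "Inv_tableau [n, n] t = range (\<lambda>c. c *\<^sub>c singlets n t)" if "t \<in> ?I" for t
    using two_row_tableau.Inv_tableau_eq[OF standard_two_row_tableau[OF that]] .
  show "Inv_space (2 * n) = {\<Sum>t\<in>?I. v t | v. v \<in> Pi ?I (Inv_tableau [n, n])}"
  proof
    show "Inv_space (2 * n) \<subseteq> {\<Sum>t\<in>?I. v t | v. v \<in> Pi ?I (Inv_tableau [n, n])}"
    proof
      fix \<psi> assume "\<psi> \<in> Inv_space (2 * n)"
      then obtain c where "\<psi> = (\<Sum>t\<in>?I. c t *\<^sub>c singlets n t)"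
        using Inv_space_expansion[of \<psi> n ?I] by blast
      moreover have "(\<lambda>t. c t *\<^sub>c singlets n t) \<in> Pi ?I (Inv_tableau [n, n])"
        using W by auto
      ultimately show "\<psi> \<in> {\<Sum>t\<in>?I. v t | v. v \<in> Pi ?I (Inv_tableau [n, n])}"
        by blast
    qed
    show "{\<Sum>t\<in>?I. v t | v. v \<in> Pi ?I (Inv_tableau [n, n])} \<subseteq> Inv_space (2 * n)"
      using two_row_tableau.Inv_tableau_subset[OF standard_two_row_tableau]
      by (auto intro!: cfun.subspace_sum subspace_Inv_space)
  qed
  fix v t assume v: "v \<in> Pi ?I (Inv_tableau [n, n])" "(\<Sum>t\<in>?I. v t) = 0" and t: "t \<in> ?I"
  have "\<forall>t\<in>?I. \<exists>c. v t = c *\<^sub>c singlets n t"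
    using v(1) W by (force simp: Pi_iff)
  then obtain c where c: "\<And>t. t \<in> ?I \<Longrightarrow> v t = c t *\<^sub>c singlets n t"
    by metis
  then have "(\<Sum>t\<in>?I. c t *\<^sub>c singlets n t) = 0"
    using v(2) by simp
  then show "v t = 0"
    using singlets_independent[OF _ t] c[OF t] by simp
qed

text \<open>A nonzero coefficient would belong to a word with as many zeros as ones, which makes the
  length even.\<close>

lemma Inv_space_odd:
  assumes "odd N"
  shows "Inv_space N = {0}"
proof
  show "Inv_space N \<subseteq> {0}"
  proof
    fix \<psi> assume \<psi>: "\<psi> \<in> Inv_space N"
    have "\<psi> w = 0" for w
    proof (rule ccontr)
      assume "\<psi> w \<noteq> 0"
      moreover from this have "w \<in> words N"
        using \<psi> by (auto simp: Inv_space_def tensors_def)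
      ultimately have "card {i \<in> {1..N}. w i = 0} = card {i \<in> {1..N}. w i = 1}"
        using Inv_space_weight_zero[OF \<psi>] by blast
      with card_zeros_ones[of N w] have "N = 2 * card {i \<in> {1..N}. w i = 1}"
        by linarith
      with assms show False
        by (metis dvd_triv_left)
    qed
    then show "\<psi> \<in> {0}"
      by (simp add: fun_eq_iff)
  qed
qed (simp add: cfun.subspace_0 subspace_Inv_space)

theorem lemma2:
  fixes N :: nat and \<mu> :: "nat list"
  assumes "N \<ge> 1"
    and "\<mu> = [N div 2, N div 2]"
  shows "(odd N \<longrightarrow> Inv_space N = {0}) \<and>
    (even N \<longrightarrow>
      is_direct_sum (Inv_space N) (standard_tableaux \<mu>) (Inv_tableau \<mu>) \<and>
      (\<forall>T\<in>standard_tableaux \<mu>.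
        B_irreducible N (Inv_tableau \<mu> T) \<and> cfun.dim (Inv_tableau \<mu> T) = 1))"
proof (intro conjI impI ballI)
  assume "odd N"
  then show "Inv_space N = {0}"
    by (rule Inv_space_odd)
next
  assume "even N"
  then have N: "N = 2 * (N div 2)"
    by simp
  then show "is_direct_sum (Inv_space N) (standard_tableaux \<mu>) (Inv_tableau \<mu>)"
    using is_direct_sum_Inv_space[of "N div 2"] assms(2) by simp
  fix T assume "T \<in> standard_tableaux \<mu>"
  then interpret two_row_tableau "N div 2" T
    unfolding assms(2) by (rule standard_two_row_tableau)
  show "B_irreducible N (Inv_tableau \<mu> T)"
    using B_irreducible_Inv_tableau N assms(2) by simp
  show "cfun.dim (Inv_tableau \<mu> T) = 1"
    using dim_Inv_tableau assms(2) by simp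
qed

end
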